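(* The following define valid conditional resampling schemes: (i) the conditional killing resampling $\rho_{\mathrm{kill}}^{(i,k)}(\cdot\mid g^{(1:N)})$, $i,k\in[N]$; (ii) the conditional systematic resampling with mean partition $\rho_{\mathrm{syst}}^{(i,k)}(\cdot\mid g^{(1:N)})$, $i,k\in[N]$.
   Context: Notation. $N$ is a positive integer (the number of particles); $[N]=\{1,\dots,N\}$; $y^{(1:N)}=(y^{(1)},\dots,y^{(N)})$; $y^{(-n)}$ is $y^{(1:N)}$ with the $n$th entry removed; $\mathbf{1}(\cdot)$ is an indicator; $\mathcal{U}(a,b)$ and $\mathcal{U}([n])$ are the uniform distributions on the interval $(a,b)$ and on $[n]$. For integer $s$, $\sigma_s:[N]\to[N]$ is the cyclic shift $\sigma_s(i)=1+\big((i+s-1)\bmod N\big)$. Validity. An (unconditional) resampling scheme $r(\cdot\mid g^{(1:N)})$ is a probability distribution on $[N]^N$ depending on non-negative unnormalised weights $g^{(1:N)}$. A conditional resampling scheme $r^{(p,n)}(\cdot\mid g^{(1:N)})$ (a distribution on $[N]^N$ for each $p,n\in[N]$) is valid if there exists an unconditional resampling scheme $r(\cdot\mid g^{(1:N)})$ such that for all $g^{(1:N)}\ge0$ with $\sum_{\ell=1}^N g^{(\ell)}>0$, and all $p,n\in[N]$: (a) $\mathbb{P}_{r^{(p,n)}(\cdot\mid g^{(1:N)})}(A^{(n)}=p)=1$; (b) $r^{(p,n)}(a^{(1:N)}\mid g^{(1:N)})=\mathbb{P}_{r(\cdot\mid g^{(1:N)})}(A^{(-n)}=a^{(-n)}\mid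 A^{(n)}=p)$; (c) $\mathbb{P}_{r(\cdot\mid g^{(1:N)})}(A^{(n)}=p)=g^{(p)}/\sum_{j=1}^N g^{(j)}$. Here the subscript of $\mathbb{P}$ is the law of $A^{(1:N)}$. In the two schemes below, $(i,k)$ plays the role of $(p,n)$, i.e. the conditioning is $A^{(k)}=i$. Conditional killing $\rho_{\mathrm{kill}}^{(i,k)}(\cdot\mid g^{(1:N)})$. Let $g^*=\max_{j\in[N]}g^{(j)}$ and let $\rho_{\mathrm{kill}}$ be the (unconditional) killing resampling $$\rho_{\mathrm{kill}}(a^{(1:N)}\mid g^{(1:N)})=\prod_{m=1}^N\Big[\mathbf{1}(a^{(m)}=m)\frac{g^{(m)}}{g^*}+\Big(1-\frac{g^{(m)}}{g^*}\Big)\sum_{j=1}^N\mathbf{1}(a^{(m)}=j)\frac{g^{(j)}}{\sum_{\ell=1}^Ng^{(\ell)}}\Big]$$ (defined arbitrarily if $g^*=0$). 1. Draw $\bar A^{(1:N)}\sim\rho_{\mathrm{kill}}(\cdot\mid g^{(1:N)})$. 2. Draw $J\in[N]$ with $\mathbb{P}(J=i)=\frac1N\big(1+\frac{\sum_{\ell\ne i}g^{(\ell)}}{g^*}\big)$ and $\mathbb{P}(J=j)=\frac1N\big(1-\frac{g^{(j)}}{g^*}\big)$ for $j\ne i$. 3. Set $S=\sigma_{-k}(J)$ and overwrite $\bar A^{(J)}$ with $i$. 4. Output $A^{(1:N)}$ with $A^{(j)}=\bar A^{(\sigma_S(j))}$ for $j\in[N]$. For a permutation $\varpi$ of $[N]$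 and normalised weights $W^{1:N}$, let $F_\varpi(m)=\sum_{j=1}^mW^{\varpi(j)}$ and, for $u\in(0,1)$, let $F_\varpi^{-1}(u)$ be the unique $m\in[N]$ with $F_\varpi(m-1)<u\le F_\varpi(m)$. Routine MeanPartitionOrder$(w^{1:N})$ (returns a permutation of $[N]$): 1. Set the pivot $\bar w=\frac1N\sum_{j=1}^Nw^j$; set $i_\ell=0$, $i_u=N+1$; initialise $I=(I^{(1)},\dots,I^{(N)})=(1,\dots,N)$. 2. Repeat indefinitely: (2.1) while $i_\ell<\min(i_u,N)$: increase $i_\ell$ by 1, and exit this inner loop if $w^{I^{(i_\ell)}}>\bar w$; (2.2) while $i_u>i_\ell$: decrease $i_u$ by 1, and exit this inner loop if $w^{I^{(i_u)}}<\bar w$; (2.3) if $i_\ell=i_u$, exit the repeat loop; (2.4) swap the entries of $I$ at positions $i_\ell$ and $i_u$. 3. Output $I$, i.e. the permutation $m\mapsto I^{(m)}$. Conditional systematic resampling with mean partition $\rho_{\mathrm{syst}}^{(i,k)}(\cdot\mid g^{(1:N)})$. 1. Set $W^j=g^{(j)}/\sum_{\ell=1}^N g^{(\ell)}$ for $j\in[N]$. 2. Set $\mathfrak{r}=NW^i-\lfloor NW^i\rfloor$ and $q=\mathfrak{r}(\lfloor NW^i\rfloor+1)/(NW^i)$. 3. With probability $q$, draw $\bar U\sim\mathcal{U}(0,\mathfrak{r})$ and set $N^i=\lfloor NW^i\rfloor+1$; otherwise draw $\bar U\sim\mathcal{U}(\mathfrak{r},1)$ and set $N^i=\lfloor NW^i\rfloor$.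 4. Set $\varpi=$ MeanPartitionOrder$(W^{1:N})$. 5. Set $s=\varpi^{-1}(i)$ and $\tilde\varpi(j)=\varpi(\sigma_{s-1}(j))$ for $j\in[N]$. 6. Set $\bar A^{(j)}=\tilde\varpi\big(F_{\tilde\varpi}^{-1}(U^j)\big)$ where $U^j=(j-1+\bar U)/N$, for $j\in[N]$. 7. Draw $\bar C\sim\mathcal{U}([N^i])$ and set $C=\sigma_{-k}(\bar C)$. 8. Output $A^{(1:N)}$ with $A^{(j)}=\bar A^{(\sigma_C(j))}$ for $j\in[N]$.
   Formalization: In (ii), if g^(i)=0 the scheme is undefined (q=0/0, uniform draw from an empty set); there any law on [N]^N with A^(k)=i almost surely is allowed. Validity (b) is required only for a^(n)=p and when A^(n)=p has positive probability. *)

theory Defs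
  imports "HOL-Probability.Probability"
begin

text \<open>
  Tuples indexed by \<open>1, \<dots>, N\<close> are extensional functions on \<open>{1..N}\<close>.  Weight vectors that
  vanish identically are left out of \<open>weights\<close>, since neither validity nor the schemes say
  anything about them.
\<close>

definition weights :: "nat \<Rightarrow> (nat \<Rightarrow> real) set" where
  "weights N = {g \<in> {1..N} \<rightarrow>\<^sub>E {0..}. (\<Sum>l=1..N. g l) > 0}"

definition ancestors :: "nat \<Rightarrow> (nat \<Rightarrow> nat) set" where
  "ancestors N = {1..N} \<rightarrow>\<^sub>E {1..N}"

definition shift :: "nat \<Rightarrow> int \<Rightarrow> nat \<Rightarrow> nat" where
  "shift N s i = nat (1 + (int i + s - 1) mod int N)"


subsection \<open>Validity\<close>

type_synonym scheme = "(nat \<Rightarrow> real) \<Rightarrow> (nat \<Rightarrow> nat) pmf"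

type_synonym cond_scheme = "nat \<Rightarrow> nat \<Rightarrow> scheme"

definition is_scheme :: "nat \<Rightarrow> scheme \<Rightarrow> bool" where
  "is_scheme N r \<longleftrightarrow> (\<forall>g\<in>weights N. set_pmf (r g) \<subseteq> ancestors N)"

definition is_cond_scheme :: "nat \<Rightarrow> cond_scheme \<Rightarrow> bool" where
  "is_cond_scheme N R \<longleftrightarrow> (\<forall>p\<in>{1..N}. \<forall>n\<in>{1..N}. is_scheme N (R p n))"

text \<open>
  In the second clause below the conditional probability only makes sense if the event
  \<open>A n = p\<close> has positive probability (\<^const>\<open>cond_prob\<close> would return 0 otherwise).  Its right-hand
  side does not involve \<open>a n\<close>, so the equation is meant for tuples with \<open>a n = p\<close>; the
  mass of all other tuples is 0 by the first clause.
\<close>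

definition valid :: "nat \<Rightarrow> cond_scheme \<Rightarrow> bool" where
  "valid N R \<longleftrightarrow> is_cond_scheme N R \<and>
    (\<exists>r. is_scheme N r \<and>
      (\<forall>g\<in>weights N. \<forall>p\<in>{1..N}. \<forall>n\<in>{1..N}.
        \<P>(A in R p n g. A n = p) = 1 \<and>
        (\<P>(A in r g. A n = p) > 0 \<longrightarrow>
          (\<forall>a\<in>ancestors N. a n = p \<longrightarrow>
            pmf (R p n g) a = \<P>(A in r g. (\<forall>m\<in>{1..N} - {n}. A m = a m) \<bar> A n = p))) \<and>
        \<P>(A in r g. A n = p) = g p / (\<Sum>j=1..N. g j)))"


subsection \<open>Conditional killing resampling\<close>

definition max_weight :: "nat \<Rightarrow> (nat \<Rightarrow> real) \<Rightarrow> real" where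
  "max_weight N g = Max (g ` {1..N})"

definition kill_mass :: "nat \<Rightarrow> (nat \<Rightarrow> real) \<Rightarrow> (nat \<Rightarrow> nat) \<Rightarrow> real" where
  "kill_mass N g a =
    (if a \<in> ancestors N
     then \<Prod>m=1..N. of_bool (a m = m) * (g m / max_weight N g) +
            (1 - g m / max_weight N g) *
            (\<Sum>j=1..N. of_bool (a m = j) * (g j / (\<Sum>l=1..N. g l)))
     else 0)"

definition kill :: "nat \<Rightarrow> scheme" where
  "kill N g = embed_pmf (kill_mass N g)"

definition kill_index_mass :: "nat \<Rightarrow> nat \<Rightarrow> (nat \<Rightarrow> real) \<Rightarrow> nat \<Rightarrow> real" where
  "kill_index_mass N i g j =
    (if j \<notin> {1..N} then 0
     else if j = i then 1 / N * (1 + (\<Sum>l\<in>{1..N} - {i}. g l) / max_weight N g)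
     else 1 / N * (1 - g j / max_weight N g))"

definition kill_index :: "nat \<Rightarrow> nat \<Rightarrow> (nat \<Rightarrow> real) \<Rightarrow> nat pmf" where
  "kill_index N i g = embed_pmf (kill_index_mass N i g)"

definition cond_kill :: "nat \<Rightarrow> cond_scheme" where
  "cond_kill N i k g =
    do {
      A' \<leftarrow> kill N g;
      J \<leftarrow> kill_index N i g;
      let S = shift N (- int k) J;
      let A'' = A'(J := i);
      return_pmf (\<lambda>j\<in>{1..N}. A'' (shift N (int S) j))
    }"


subsection \<open>Mean partition order\<close>

function scan_up :: "(nat \<Rightarrow> bool) \<Rightarrow> nat \<Rightarrow> nat \<Rightarrow> nat" where
  "scan_up P b l = (if l < b then if P (l + 1) then l + 1 else scan_up P b (l + 1) else l)"
  by pat_completeness auto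
termination by (relation "Wellfounded.measure (\<lambda>(P, b, l). b - l)") auto

function scan_down :: "(nat \<Rightarrow> bool) \<Rightarrow> nat \<Rightarrow> nat \<Rightarrow> nat" where
  "scan_down P b u = (if u > b then if P (u - 1) then u - 1 else scan_down P b (u - 1) else u)"
  by pat_completeness auto
termination by (relation "Wellfounded.measure (\<lambda>(P, b, u). u - b)") auto

declare scan_up.simps [simp del] scan_down.simps [simp del]

partial_function (tailrec) partition_loop ::
    "nat \<Rightarrow> (nat \<Rightarrow> real) \<Rightarrow> real \<Rightarrow> (nat \<Rightarrow> nat) \<Rightarrow> nat \<Rightarrow> nat \<Rightarrow> nat \<Rightarrow> nat" where
  "partition_loop N w pivot I il iu =
    (let il' = scan_up (\<lambda>x. w (I x) > pivot) (min iu N) il;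
         iu' = scan_down (\<lambda>x. w (I x) < pivot) il' iu
     in if il' = iu' then I
        else partition_loop N w pivot (I(il' := I iu', iu' := I il')) il' iu')"

definition mean_partition_order :: "nat \<Rightarrow> (nat \<Rightarrow> real) \<Rightarrow> nat \<Rightarrow> nat" where
  "mean_partition_order N w = partition_loop N w (1 / N * (\<Sum>j=1..N. w j)) (\<lambda>m. m) 0 (N + 1)"


subsection \<open>Conditional systematic resampling\<close>

definition order_cdf :: "(nat \<Rightarrow> real) \<Rightarrow> (nat \<Rightarrow> nat) \<Rightarrow> nat \<Rightarrow> real" where
  "order_cdf W \<pi> m = (\<Sum>j=1..m. W (\<pi> j))"

definition order_quantile :: "nat \<Rightarrow> (nat \<Rightarrow> real) \<Rightarrow> (nat \<Rightarrow> nat) \<Rightarrow> real \<Rightarrow> nat" where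
  "order_quantile N W \<pi> u =
    (THE m. m \<in> {1..N} \<and> order_cdf W \<pi> (m - 1) < u \<and> u \<le> order_cdf W \<pi> m)"

definition systematic :: "nat \<Rightarrow> (nat \<Rightarrow> real) \<Rightarrow> (nat \<Rightarrow> nat) \<Rightarrow> real \<Rightarrow> nat \<Rightarrow> nat" where
  "systematic N W \<pi> u = (\<lambda>j\<in>{1..N}. \<pi> (order_quantile N W \<pi> ((real j - 1 + u) / N)))"

text \<open>
  The law of \<open>systematic N W \<pi> U\<close> for \<open>U\<close> uniform on the interval from \<open>lo\<close> to \<open>hi\<close>.  Only
  finitely many tuples are possible, so that it is a \<^typ>\<open>'a pmf\<close> although \<open>U\<close> has a density.
\<close>

definition systematic_pmf ::
    "nat \<Rightarrow> (nat \<Rightarrow> real) \<Rightarrow> (nat \<Rightarrow> nat) \<Rightarrow> real \<Rightarrow> real \<Rightarrow> (nat \<Rightarrow> nat) pmf" where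
  "systematic_pmf N W \<pi> lo hi =
    Abs_pmf (distr (uniform_measure lborel {lo<..<hi}) (count_space UNIV) (systematic N W \<pi>))"

text \<open>
  If \<open>g i = 0\<close>, then \<open>q\<close> is 0/0 and the uniform distribution on \<open>{1..Ni}\<close> is over the empty set,
  so the algorithm does not define a law.  This case is delegated to the parameter \<open>R0\<close>.
\<close>

definition cond_syst :: "nat \<Rightarrow> cond_scheme \<Rightarrow> cond_scheme" where
  "cond_syst N R0 i k g =
    (if g i = 0 then R0 i k g
     else
       let W = (\<lambda>j. g j / (\<Sum>l=1..N. g l));
           n = nat \<lfloor>N * W i\<rfloor>;
           \<rr> = N * W i - n;
           q = \<rr> * (n + 1) / (N * W i);
           \<pi> = mean_partition_order N W;
           s = inv_into {1..N} \<pi> i;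
           \<pi>' = (\<lambda>j. \<pi> (shift N (int s - 1) j))
       in do {
         b \<leftarrow> bernoulli_pmf q;
         let Ni = (if b then n + 1 else n);
         A' \<leftarrow> (if b then systematic_pmf N W \<pi>' 0 \<rr> else systematic_pmf N W \<pi>' \<rr> 1);
         C' \<leftarrow> pmf_of_set {1..Ni};
         let C = shift N (- int k) C';
         return_pmf (\<lambda>j\<in>{1..N}. A' (shift N (int C) j))
       })"


subsection \<open>Well-definedness\<close>

text \<open>
  The mass functions passed to \<^const>\<open>embed_pmf\<close> and the measure passed to \<open>Abs_pmf\<close> are
  probability distributions, the partition loop terminates with a permutation, and
  \<^const>\<open>order_quantile\<close> is determined uniquely.
\<close>

lemma finite_ancestors: "finite (ancestors N)"
  unfolding ancestors_def by (intro finite_PiE) auto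

lemma weightsD:
  assumes "g \<in> weights N"
  shows "\<And>j. j \<in> {1..N} \<Longrightarrow> 0 \<le> g j" "(\<Sum>l=1..N. g l) > 0" "max_weight N g > 0"
    "\<And>j. j \<in> {1..N} \<Longrightarrow> g j \<le> max_weight N g" "N > 0"
proof -
  show nonneg: "\<And>j. j \<in> {1..N} \<Longrightarrow> 0 \<le> g j" and pos: "(\<Sum>l=1..N. g l) > 0"
    using assms unfolding weights_def by (auto simp: PiE_iff)
  show le: "\<And>j. j \<in> {1..N} \<Longrightarrow> g j \<le> max_weight N g"
    unfolding max_weight_def by (intro Max_ge) auto
  obtain j where "j \<in> {1..N}" "g j > 0"
    using pos sum_nonpos[of "{1..N}" g] by (meson not_le)
  then show "max_weight N g > 0" "N > 0"
    using le[of j] by auto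
qed

lemma pmf_kill:
  assumes "g \<in> weights N"
  shows "pmf (kill N g) a = kill_mass N g a"
proof -
  note g = weightsD[OF assms]
  let ?M = "max_weight N g" and ?G = "\<Sum>l=1..N. g l"
  define f where "f m x = of_bool (x = m) * (g m / ?M) +
    (1 - g m / ?M) * (\<Sum>j=1..N. of_bool (x = j) * (g j / ?G))" for m x :: nat
  have f_nonneg: "0 \<le> f m x" if "m \<in> {1..N}" for m x
    unfolding f_def using g that
    by (intro add_nonneg_nonneg mult_nonneg_nonneg sum_nonneg divide_nonneg_pos) auto
  have f_sum: "(\<Sum>x\<in>{1..N}. f m x) = 1" if "m \<in> {1..N}" for m
  proof -
    have *: "(\<Sum>x\<in>{1..N}. of_bool (x = j) * c) = c" if "j \<in> {1..N}" for j and c :: real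
      using that by (subst sum.remove) (auto intro!: sum.neutral)
    have "(\<Sum>x\<in>{1..N}. \<Sum>j=1..N. of_bool (x = j) * (g j / ?G)) = (\<Sum>j=1..N. g j / ?G)"
      by (subst sum.swap) (intro sum.cong refl *)
    also have "\<dots> = 1"
      using g(2) by (simp flip: sum_divide_distrib)
    finally have S: "(\<Sum>x\<in>{1..N}. \<Sum>j=1..N. of_bool (x = j) * (g j / ?G)) = 1" .
    have "(\<Sum>x\<in>{1..N}. f m x) = (\<Sum>x\<in>{1..N}. of_bool (x = m) * (g m / ?M)) +
        (1 - g m / ?M) * (\<Sum>x\<in>{1..N}. \<Sum>j=1..N. of_bool (x = j) * (g j / ?G))"
      unfolding f_def by (simp only: sum.distrib sum_distrib_left)
    also have "\<dots> = 1"
      unfolding S *[OF that] by simp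
    finally show ?thesis .
  qed
  have mass: "kill_mass N g a = (if a \<in> ancestors N then \<Prod>m=1..N. f m (a m) else 0)" for a
    by (simp add: kill_mass_def f_def)
  have nonneg: "0 \<le> kill_mass N g a" for a
    unfolding mass by (auto intro!: prod_nonneg f_nonneg)
  have "(\<integral>\<^sup>+a. ennreal (kill_mass N g a) \<partial>count_space UNIV) =
      (\<integral>\<^sup>+a. ennreal (kill_mass N g a) \<partial>count_space (ancestors N))"
    by (subst nn_integral_count_space_indicator)
       (auto intro!: nn_integral_cong simp: mass indicator_def)
  also have "\<dots> = ennreal (\<Sum>a\<in>ancestors N. kill_mass N g a)"
    using nonneg by (simp add: nn_integral_count_space_finite finite_ancestors sum_ennreal)
  also have "(\<Sum>a\<in>ancestors N. kill_mass N g a) = (\<Prod>m=1..N. \<Sum>x\<in>{1..N}. f m x)"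
    by (subst prod_sum_PiE) (auto simp: mass ancestors_def)
  also have "\<dots> = 1"
    by (intro prod.neutral ballI f_sum)
  finally show ?thesis
    unfolding kill_def using nonneg by (simp add: pmf_embed_pmf)
qed

lemma pmf_kill_index:
  assumes "g \<in> weights N" "i \<in> {1..N}"
  shows "pmf (kill_index N i g) j = kill_index_mass N i g j"
proof -
  note g = weightsD[OF assms(1)]
  let ?M = "max_weight N g"
  have nonneg: "0 \<le> kill_index_mass N i g j" for j
    unfolding kill_index_mass_def using g
    by (auto intro!: mult_nonneg_nonneg add_nonneg_nonneg divide_nonneg_pos sum_nonneg)
  have "(\<integral>\<^sup>+j. ennreal (kill_index_mass N i g j) \<partial>count_space UNIV) =
      (\<integral>\<^sup>+j. ennreal (kill_index_mass N i g j) \<partial>count_space {1..N})"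
    by (subst nn_integral_count_space_indicator)
       (auto intro!: nn_integral_cong simp: kill_index_mass_def indicator_def)
  also have "\<dots> = ennreal (\<Sum>j\<in>{1..N}. kill_index_mass N i g j)"
    using nonneg by (simp add: nn_integral_count_space_finite sum_ennreal)
  also have "(\<Sum>j\<in>{1..N}. kill_index_mass N i g j) =
      1 / N * (1 + (\<Sum>l\<in>{1..N} - {i}. g l) / ?M) + (\<Sum>j\<in>{1..N} - {i}. 1 / N * (1 - g j / ?M))"
    using assms(2) by (subst sum.remove[of _ i]) (auto simp: kill_index_mass_def intro!: sum.cong)
  also have "(\<Sum>j\<in>{1..N} - {i}. 1 / N * (1 - g j / ?M)) =
      1 / N * (real (N - 1) - (\<Sum>l\<in>{1..N} - {i}. g l) / ?M)"
    using assms(2) unfolding sum_distrib_left[symmetric] sum_subtractf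
    by (simp add: sum_divide_distrib)
  also have "1 / N * (1 + (\<Sum>l\<in>{1..N} - {i}. g l) / ?M) + \<dots> = 1"
    using g(5) unfolding distrib_left[symmetric] by (simp add: of_nat_diff)
  finally show ?thesis
    unfolding kill_index_def using nonneg by (simp add: pmf_embed_pmf)
qed

lemma measurable_order_quantile [measurable]:
  "order_quantile N W \<pi> \<in> measurable borel (count_space UNIV)"
proof -
  define P where "P u m \<longleftrightarrow> order_cdf W \<pi> (m - 1) < u \<and> u \<le> order_cdf W \<pi> m" for u m
  have "{u. order_quantile N W \<pi> u = a} \<in> sets borel" for a
  proof -
    have "{u. order_quantile N W \<pi> u = a} =
        (\<Union>S\<in>{S \<in> Pow {1..N}. (THE m. m \<in> S) = a}. {u. \<forall>m\<in>{1..N}. P u m \<longleftrightarrow> m \<in> S})"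
      (is "?L = ?R")
    proof (intro equalityI subsetI)
      fix u assume "u \<in> ?L"
      then show "u \<in> ?R"
        by (intro UN_I[of "{m \<in> {1..N}. P u m}"]) (auto simp: order_quantile_def P_def)
    next
      fix u assume "u \<in> ?R"
      then obtain S where S: "S \<subseteq> {1..N}" "(THE m. m \<in> S) = a" "\<forall>m\<in>{1..N}. P u m \<longleftrightarrow> m \<in> S"
        by auto
      then have "m \<in> S \<longleftrightarrow> m \<in> {1..N} \<and> P u m" for m by blast
      then show "u \<in> ?L" using S(2) by (simp add: order_quantile_def P_def)
    qed
    also have "\<dots> = (\<Union>S\<in>{S \<in> Pow {1..N}. (THE m. m \<in> S) = a}.
        {u \<in> space borel. \<forall>m\<in>{1..N}. P u m \<longleftrightarrow> m \<in> S})"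
      by simp
    also have "\<dots> \<in> sets borel"
    proof (rule sets.finite_UN)
      show "{u \<in> space borel. \<forall>m\<in>{1..N}. P u m \<longleftrightarrow> m \<in> S} \<in> sets borel" for S
        unfolding P_def by measurable
    qed simp
    finally show ?thesis .
  qed
  then show ?thesis
    by (subst measurable_count_space_eq2_countable) (auto simp: vimage_def)
qed

lemma measure_systematic_pmf:
  assumes "lo < hi"
  shows "measure_pmf (systematic_pmf N W \<pi> lo hi) =
    distr (uniform_measure lborel {lo<..<hi}) (count_space UNIV) (systematic N W \<pi>)"
proof -
  let ?U = "uniform_measure lborel {lo<..<hi}"
  define S where "S = {1..N} \<rightarrow>\<^sub>E range \<pi>"
  have S: "countable S" "systematic N W \<pi> u \<in> S" for u
    unfolding S_def by (auto intro!: countable_PiE simp: systematic_def)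
  have U: "prob_space ?U"
    using assms by (intro prob_space_uniform_measure) auto
  have "{u. systematic N W \<pi> u = a} \<in> sets borel" if "a \<in> S" for a
  proof -
    have "{u. systematic N W \<pi> u = a} =
        {u \<in> space borel. \<forall>j\<in>{1..N}. \<pi> (order_quantile N W \<pi> ((real j - 1 + u) / N)) = a j}"
      using that unfolding S_def systematic_def
      by (auto simp: PiE_iff extensional_def restrict_def fun_eq_iff)
    also have "\<dots> \<in> sets borel"
      by measurable
    finally show ?thesis .
  qed
  then have "systematic N W \<pi> \<in> measurable ?U (count_space S)"
    using S measurable_count_space_eq_countable[OF S(1), of "systematic N W \<pi>" ?U]
    by (auto simp: vimage_def)
  then have meas [measurable]: "systematic N W \<pi> \<in> measurable ?U (count_space UNIV)"
    using measurable_compose[of "systematic N W \<pi>" ?U "count_space S" "\<lambda>a. a" "count_space UNIV"]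
    by simp
  interpret D: prob_space "distr ?U (count_space UNIV) (systematic N W \<pi>)"
    using U meas by (rule prob_space.prob_space_distr)
  have "AE a in distr ?U (count_space UNIV) (systematic N W \<pi>). a \<in> S"
    using S(2) by (subst AE_distr_iff) auto
  then have "AE a in distr ?U (count_space UNIV) (systematic N W \<pi>).
      measure (distr ?U (count_space UNIV) (systematic N W \<pi>)) {a} \<noteq> 0"
    using S(1) D.AE_support_countable by auto
  then show ?thesis
    unfolding systematic_pmf_def by (intro Abs_pmf_inverse) (auto intro: D.prob_space_axioms)
qed

lemma scan_up_bounds:
  "l \<le> b \<Longrightarrow> l \<le> scan_up P b l \<and> scan_up P b l \<le> b \<and> (l < b \<longrightarrow> l < scan_up P b l)"
proof (induction P b l rule: scan_up.induct)
  case (1 P b l)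
  then show ?case
    using scan_up.simps[of P b l] by (cases "l < b"; cases "P (l + 1)") auto
qed

lemma scan_down_bounds:
  "b \<le> u \<Longrightarrow> b \<le> scan_down P b u \<and> scan_down P b u \<le> u \<and> (b < u \<longrightarrow> scan_down P b u < u)"
proof (induction P b u rule: scan_down.induct)
  case (1 P b u)
  then show ?case
    using scan_down.simps[of P b u] by (cases "b < u"; cases "P (u - 1)") fastforce+
qed

lemma partition_loop_permutes:
  assumes "I permutes {1..N}" "il \<le> iu" "il \<le> N" "iu \<le> N + 1" "N > 0"
  shows "partition_loop N w pivot I il iu permutes {1..N}"
  using assms
proof (induction "iu - il" arbitrary: I il iu rule: less_induct)
  case less
  define il' where "il' = scan_up (\<lambda>x. w (I x) > pivot) (min iu N) il"
  define iu' where "iu' = scan_down (\<lambda>x. w (I x) < pivot) il' iu"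
  have il': "il \<le> il'" "il' \<le> iu" "il' \<le> N" "il < min iu N \<Longrightarrow> il < il'"
    using scan_up_bounds[of il "min iu N" "\<lambda>x. w (I x) > pivot"] less.prems
    by (auto simp: il'_def)
  have iu': "il' \<le> iu'" "iu' \<le> iu" "il' < iu \<Longrightarrow> iu' < iu"
    using scan_down_bounds[of il' iu "\<lambda>x. w (I x) < pivot"] il' by (auto simp: iu'_def)
  have loop: "partition_loop N w pivot I il iu = (if il' = iu' then I
      else partition_loop N w pivot (I(il' := I iu', iu' := I il')) il' iu')"
    unfolding il'_def iu'_def by (subst partition_loop.simps) (simp only: Let_def)
  show ?case
  proof (cases "il' = iu'")
    case True
    then show ?thesis
      using less.prems by (simp add: loop)
  next
    case False
    have *: "I(il' := I iu', iu' := I il') = I \<circ> Transposition.transpose il' iu'"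
      by (auto simp: fun_eq_iff Transposition.transpose_def)
    have "il' \<noteq> 0" "il' \<in> {1..N}" "iu' \<in> {1..N}"
      using False il' iu' less.prems by (auto split: if_splits)
    then have "I(il' := I iu', iu' := I il') permutes {1..N}"
      unfolding * using less.prems by (intro permutes_compose permutes_swap_id) auto
    then have "partition_loop N w pivot (I(il' := I iu', iu' := I il')) il' iu' permutes {1..N}"
      using False il' iu' less.prems by (intro less.hyps) auto
    then show ?thesis
      using False by (simp add: loop)
  qed
qed

lemma mean_partition_order_permutes:
  "N > 0 \<Longrightarrow> mean_partition_order N w permutes {1..N}"
  unfolding mean_partition_order_def
  by (intro partition_loop_permutes) (auto simp: permutes_def)

lemma order_quantile_correct:
  assumes "\<And>j. j \<in> {1..N} \<Longrightarrow> 0 \<le> W j" "(\<Sum>j=1..N. W j) = 1" "\<pi> permutes {1..N}" "0 < u" "u < 1"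
  shows "\<exists>!m. m \<in> {1..N} \<and> order_cdf W \<pi> (m - 1) < u \<and> u \<le> order_cdf W \<pi> m"
proof -
  have "order_cdf W \<pi> N = (\<Sum>j=1..N. W j)"
    unfolding order_cdf_def by (subst sum.permute[OF assms(3), of W]) (simp add: comp_def)
  then have top: "order_cdf W \<pi> N = 1"
    by (simp only: assms(2))
  have bot: "order_cdf W \<pi> 0 = 0"
    by (simp add: order_cdf_def)
  have nonneg: "0 \<le> W (\<pi> j)" if "j \<in> {1..N}" for j
    using that permutes_in_image[OF assms(3)] by (intro assms(1)) blast
  have mono: "order_cdf W \<pi> a \<le> order_cdf W \<pi> b" if "a \<le> b" "b \<le> N" for a b
    unfolding order_cdf_def using that by (intro sum_mono2 nonneg) auto
  define m where "m = (LEAST m. u \<le> order_cdf W \<pi> m)"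
  have top': "u \<le> order_cdf W \<pi> N"
    using top assms(5) by linarith
  have m: "u \<le> order_cdf W \<pi> m" "m \<le> N"
    unfolding m_def using top' by (rule LeastI, rule Least_le)
  have "m \<noteq> 0"
  proof
    assume "m = 0"
    then show False using m(1) bot assms(4) by simp
  qed
  then have "m - 1 < (LEAST m. u \<le> order_cdf W \<pi> m)"
    by (simp flip: m_def)
  from not_less_Least[OF this] have less: "order_cdf W \<pi> (m - 1) < u"
    by simp
  show ?thesis
  proof (rule ex1I[of _ m])
    show "m \<in> {1..N} \<and> order_cdf W \<pi> (m - 1) < u \<and> u \<le> order_cdf W \<pi> m"
      using m less \<open>m \<noteq> 0\<close> by simp
  next
    fix k assume k: "k \<in> {1..N} \<and> order_cdf W \<pi> (k - 1) < u \<and> u \<le> order_cdf W \<pi> k"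
    then have "m \<le> k"
      unfolding m_def by (intro Least_le) simp
    moreover have "\<not> m \<le> k - 1"
    proof
      assume "m \<le> k - 1"
      then have "order_cdf W \<pi> m \<le> order_cdf W \<pi> (k - 1)"
        using k by (intro mono) auto
      then show False using k m(1) by linarith
    qed
    ultimately show "k = m" by linarith
  qed
qed

end

theory Submission
  imports Defs
begin

text \<open>
  Rotating an unconditional scheme \<open>\<mu>\<close> by a uniform cyclic shift gives a scheme in which every
  particle has the same marginal law, and this is the witness \<open>r\<close> in both cases.  Parametrising the
  shift by the index \<open>J\<close> that is moved to position \<open>k\<close>, the event \<open>A k = i\<close> for the rotated tuple
  becomes \<open>A J = i\<close> for the pair \<open>(A, J)\<close> distributed as \<open>\<mu>\<close> times uniform.  Both algorithms sample
  exactly this pair conditioned on \<open>A J = i\<close> and then rotate.  For the systematic scheme, \<open>\<mu>\<close> uses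
  the order that starts with \<open>i\<close>, so that the indices \<open>J\<close> with \<open>A J = i\<close> form an initial block;
  the rotated law does not depend on \<open>i\<close>, because moving the start of the order only translates the
  uniform variable modulo 1 and shifts the tuple cyclically.
\<close>

subsection \<open>Rotation by a uniform shift\<close>

lemma shift_in: "N > 0 \<Longrightarrow> shift N s i \<in> {1..N}"
  using pos_mod_bound[of "int N" "int i + s - 1"] pos_mod_sign[of "int N" "int i + s - 1"]
  unfolding shift_def atLeastAtMost_iff by linarith

lemma int_shift: "N > 0 \<Longrightarrow> int (shift N s i) = 1 + (int i + s - 1) mod int N"
  unfolding shift_def by simp

lemma shift_shift: "N > 0 \<Longrightarrow> shift N s (shift N t i) = shift N (s + t) i"
  unfolding shift_def[of N s] shift_def[of N "s + t"]
  by (simp add: int_shift mod_simps algebra_simps)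

lemma shift_mod: "shift N (s mod int N) i = shift N s i"
  using mod_add_right_eq[of "int i - 1" s "int N"] by (simp add: shift_def algebra_simps)

lemma shift_cong: "s mod int N = t mod int N \<Longrightarrow> shift N s i = shift N t i"
  by (metis shift_mod)

lemma shift_0: "i \<in> {1..N} \<Longrightarrow> shift N 0 i = i"
  unfolding shift_def by auto

lemma int_shift_mod: "N > 0 \<Longrightarrow> int (shift N s i) mod int N = (int i + s) mod int N"
  by (simp add: int_shift mod_simps)

text \<open>The amount of a shift matters only modulo \<open>N\<close>, so the outer shift is by
  \<open>J - k\<close>, and moving \<open>k\<close> by \<open>J - k\<close> is moving
  \<open>J\<close> by 0. Hence this is the rotation that brings index \<open>J\<close> to position
  \<open>k\<close>.\<close>

lemma shift_shift_neg:
  assumes "J \<in> {1..N}"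
  shows "shift N (int (shift N (- int k) J)) k = J"
proof -
  have "N > 0" using assms by auto
  have "shift N (int (shift N (- int k) J)) k = shift N (int J - int k) k"
    using \<open>N > 0\<close> by (intro shift_cong) (simp add: int_shift_mod)
  also have "\<dots> = shift N 0 J"
    by (simp add: shift_def)
  finally show ?thesis using assms by (simp add: shift_0)
qed

lemma bij_shift: "N > 0 \<Longrightarrow> bij_betw (shift N s) {1..N} {1..N}"
  by (intro bij_betwI[where g = "shift N (- s)"]) (auto simp: shift_shift shift_0 shift_in[simplified])

lemma shift_nat:
  assumes "j \<in> {1..N}" "c \<le> N"
  shows "shift N (int c) j = (if j + c \<le> N then j + c else j + c - N)"
proof (cases "j + c \<le> N")
  case True
  then have "(int j + int c - 1) mod int N = int j + int c - 1"
    using assms by (intro mod_pos_pos_trivial) auto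
  then show ?thesis using True by (simp add: shift_def)
next
  case False
  have "(int j + int c - 1) mod int N = (int j + int c - 1 - int N) mod int N"
    by simp
  also have "\<dots> = int j + int c - 1 - int N"
    using False assms by (intro mod_pos_pos_trivial) auto
  finally show ?thesis using False by (simp add: shift_def)
qed

section \<open>Rotated tuples and uniformly rotated laws\<close>

definition rotate_tuple :: "nat \<Rightarrow> int \<Rightarrow> (nat \<Rightarrow> 'a) \<Rightarrow> nat \<Rightarrow> 'a" where
  "rotate_tuple N s A = (\<lambda>j\<in>{1..N}. A (shift N s j))"

definition rotated_pmf :: "nat \<Rightarrow> (nat \<Rightarrow> 'a) pmf \<Rightarrow> (nat \<Rightarrow> 'a) pmf" where
  "rotated_pmf N \<mu> = \<mu> \<bind> (\<lambda>A. map_pmf (\<lambda>S. rotate_tuple N (int S) A) (pmf_of_set {1..N}))"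

lemma rotate_tuple_rotate_tuple:
  "N > 0 \<Longrightarrow> rotate_tuple N s (rotate_tuple N t A) = rotate_tuple N (s + t) A"
  unfolding rotate_tuple_def
  by (auto simp: fun_eq_iff restrict_def shift_shift shift_in[simplified] add.commute)

lemma rotate_tuple_shift: "N > 0 \<Longrightarrow> rotate_tuple N (int (shift N s i)) A = rotate_tuple N (int i + s) A"
  unfolding rotate_tuple_def
  by (auto simp: fun_eq_iff restrict_def int_shift_mod intro!: arg_cong[where f = A] shift_cong)

lemma rotate_tuple_ancestors:
  "N > 0 \<Longrightarrow> A \<in> ancestors N \<Longrightarrow> rotate_tuple N s A \<in> ancestors N"
  unfolding rotate_tuple_def ancestors_def using shift_in[of N s] by (auto simp: PiE_iff)

lemma rotate_tuple_at:
  "J \<in> {1..N} \<Longrightarrow> k \<in> {1..N} \<Longrightarrow> rotate_tuple N (int (shift N (- int k) J)) A k = A J"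
  unfolding rotate_tuple_def by (simp add: shift_shift_neg)

lemma map_shift_uniform: "N > 0 \<Longrightarrow> map_pmf (shift N s) (pmf_of_set {1..N}) = pmf_of_set {1..N}"
  by (intro map_pmf_of_set_bij_betw bij_shift) auto

text \<open>For fixed \<open>k\<close>, the map \<open>shift N (- int k)\<close> permutes
  \<open>{1..N}\<close>, so a uniform shift can be named by the index \<open>J\<close> that it
  brings to position \<open>k\<close>.\<close>

lemma rotated_pmf_conv_map:
  assumes "N > 0"
  shows "rotated_pmf N \<mu> = map_pmf (\<lambda>(A, J). rotate_tuple N (int (shift N (- int k) J)) A)
    (pair_pmf \<mu> (pmf_of_set {1..N}))"
  unfolding rotated_pmf_def
  by (subst map_shift_uniform[OF assms, symmetric, of "- int k"])
     (simp add: pair_pmf_def map_bind_pmf bind_map_pmf map_pmf_def bind_assoc_pmf bind_return_pmf)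

text \<open>A fixed rotation only translates the uniform shift modulo \<open>N\<close>, and the
  translated shift is again uniform.\<close>

lemma rotated_pmf_map_rotate:
  assumes "N > 0"
  shows "rotated_pmf N (map_pmf (rotate_tuple N c) \<mu>) = rotated_pmf N \<mu>"
proof -
  have "map_pmf (\<lambda>S. rotate_tuple N (int S) (rotate_tuple N c A)) (pmf_of_set {1..N}) =
      map_pmf (\<lambda>S. rotate_tuple N (int S) A) (map_pmf (shift N c) (pmf_of_set {1..N}))" for A :: "nat \<Rightarrow> 'a"
    unfolding pmf.map_comp o_def
    by (simp add: rotate_tuple_rotate_tuple rotate_tuple_shift assms)
  then show ?thesis
    unfolding rotated_pmf_def bind_map_pmf map_shift_uniform[OF assms] by simp
qed

lemma rotated_pmf_bind: "rotated_pmf N (bind_pmf M f) = bind_pmf M (\<lambda>x. rotated_pmf N (f x))"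
  unfolding rotated_pmf_def by (simp add: bind_assoc_pmf)

lemma set_rotated_pmf:
  "N > 0 \<Longrightarrow> set_pmf \<mu> \<subseteq> ancestors N \<Longrightarrow> set_pmf (rotated_pmf N \<mu>) \<subseteq> ancestors N"
  unfolding rotated_pmf_def by (auto intro: rotate_tuple_ancestors)

section \<open>Conditioning before and after the rotation\<close>

lemma eq_cond_pmfI:
  assumes "\<And>x. pmf \<nu> x * c = indicator s x * pmf \<kappa> x" "c > 0"
  shows "measure_pmf.prob \<kappa> s = c" "\<nu> = cond_pmf \<kappa> s"
proof -
  have "ennreal (pmf \<nu> x) * ennreal c = indicator s x * ennreal (pmf \<kappa> x)" for x
    using assms(1)[of x] assms(2)
    by (simp add: ennreal_mult'[symmetric] indicator_def split: if_splits)
  \<comment> \<open>Summing over \<open>x\<close> turns the left side into \<open>c\<close>, since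
    \<open>\<nu>\<close> has total mass 1, and the right side into the mass of \<open>s\<close>
    under \<open>\<kappa>\<close>.\<close>
  then have "(\<integral>\<^sup>+x. ennreal (pmf \<nu> x) * ennreal c \<partial>count_space UNIV) =
      (\<integral>\<^sup>+x. ennreal (pmf \<kappa> x) * indicator s x \<partial>count_space UNIV)"
    by (simp add: mult.commute)
  then have "ennreal c = emeasure (measure_pmf \<kappa>) s"
    by (simp add: nn_integral_multc nn_integral_pmf_eq_1 nn_integral_pmf'
        nn_integral_count_space_indicator[symmetric] nn_integral_pmf)
  then show c: "measure_pmf.prob \<kappa> s = c"
    using assms(2) by (simp add: measure_def)
  have "set_pmf \<kappa> \<inter> s \<noteq> {}"
    using c assms(2) by (metis measure_pmf_zero_iff less_irrefl)
  moreover have "pmf \<nu> x = indicator s x * pmf \<kappa> x / c" for x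
    using assms(1)[of x] assms(2) by (simp add: eq_divide_eq)
  ultimately show "\<nu> = cond_pmf \<kappa> s"
    by (intro pmf_eqI) (simp add: pmf_cond c)
qed

text \<open>Here \<open>\<nu>\<close> is the law of the pair (tuple, index) that an algorithm draws
  before its final rotation. The first hypothesis is Bayes' rule for the event
  \<open>A J = p\<close> under \<open>\<mu>\<close> times uniform, multiplied out by
  \<open>c\<close>. Conditioning on a preimage commutes with the rotating map, which carries the
  result over to the output.\<close>

lemma rotated_pmf_cond:
  fixes \<mu> :: "(nat \<Rightarrow> 'a) pmf"
  assumes "\<And>A J. pmf \<nu> (A, J) * c = of_bool (A J = p) * (pmf \<mu> A * (of_bool (J \<in> {1..N}) / N))"
    and "c > 0" "k \<in> {1..N}"
  shows "measure_pmf.prob (rotated_pmf N \<mu>) {A. A k = p} = c"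
    and "map_pmf (\<lambda>(A, J). rotate_tuple N (int (shift N (- int k) J)) A) \<nu> =
      cond_pmf (rotated_pmf N \<mu>) {A. A k = p}"
proof -
  define \<kappa> where "\<kappa> = pair_pmf \<mu> (pmf_of_set {1..N})"
  define T where "T = (\<lambda>(A :: nat \<Rightarrow> 'a, J). rotate_tuple N (int (shift N (- int k) J)) A)"
  have N: "N > 0" using assms(3) by auto
  have rot: "rotated_pmf N \<mu> = map_pmf T \<kappa>"
    unfolding T_def \<kappa>_def by (rule rotated_pmf_conv_map[OF N])
  \<comment> \<open>A preimage under \<open>T\<close>, as conditioning through a map needs. It is
    sure to agree with the event \<open>A J = p\<close> only for \<open>J\<close> in
    \<open>{1..N}\<close>; elsewhere \<open>\<kappa>\<close> has no mass.\<close>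
  define s where "s = T -` {A. A k = p}"
  have T: "T (A, J) k = A J" if "J \<in> {1..N}" for A J
    unfolding T_def using assms(3) that by (simp add: rotate_tuple_at)
  have \<kappa>: "pmf \<kappa> (A, J) = pmf \<mu> A * (of_bool (J \<in> {1..N}) / N)" for A J
    unfolding \<kappa>_def pmf_pair using N by (subst pmf_of_set) (auto simp: indicator_def)
  have *: "pmf \<nu> x * c = indicator s x * pmf \<kappa> x" for x
  proof -
    obtain A J where x: "x = (A, J)" by (cases x)
    show ?thesis
      unfolding x assms(1) \<kappa> using T[of J A] by (auto simp: s_def indicator_def)
  qed
  have c: "measure_pmf.prob \<kappa> s = c" and \<nu>: "\<nu> = cond_pmf \<kappa> s"
    using eq_cond_pmfI[OF *] assms(2) by auto
  show "measure_pmf.prob (rotated_pmf N \<mu>) {A. A k = p} = c"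
    unfolding rot using c by (simp add: s_def)
  have "set_pmf \<kappa> \<inter> s \<noteq> {}"
    using c assms(2) by (metis measure_pmf_zero_iff less_irrefl)
  then show "map_pmf T \<nu> = cond_pmf (rotated_pmf N \<mu>) {A. A k = p}"
    unfolding rot \<nu> s_def by (subst cond_map_pmf) auto
qed

text \<open>Conditioning needs positive probability, so marginals and conditional laws are demanded
  only for \<open>g p > 0\<close>, and a zero weight leaves a support condition. The zero marginals
  then follow: the events \<open>A n = q\<close> are disjoint and those of positive weight already
  use up mass 1.\<close>

lemma validI:
  assumes "is_scheme N r"
    and zero: "\<And>g p n. g \<in> weights N \<Longrightarrow> p \<in> {1..N} \<Longrightarrow> n \<in> {1..N} \<Longrightarrow> g p = 0 \<Longrightarrow>
      set_pmf (R p n g) \<subseteq> {A \<in> ancestors N. A n = p}"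
    and prob: "\<And>g p n. g \<in> weights N \<Longrightarrow> p \<in> {1..N} \<Longrightarrow> n \<in> {1..N} \<Longrightarrow> g p > 0 \<Longrightarrow>
      measure_pmf.prob (r g) {A. A n = p} = g p / (\<Sum>j=1..N. g j)"
    and cond: "\<And>g p n. g \<in> weights N \<Longrightarrow> p \<in> {1..N} \<Longrightarrow> n \<in> {1..N} \<Longrightarrow> g p > 0 \<Longrightarrow>
      R p n g = cond_pmf (r g) {A. A n = p}"
  shows "valid N R"
proof -
  have r: "set_pmf (r g) \<subseteq> ancestors N" if "g \<in> weights N" for g
    using assms(1) that by (auto simp: is_scheme_def)
  have prob': "measure_pmf.prob (r g) {A. A n = p} = g p / (\<Sum>j=1..N. g j)"
    if g: "g \<in> weights N" and p: "p \<in> {1..N}" and n: "n \<in> {1..N}" for g p n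
  proof (cases "g p = 0")
    case False
    then show ?thesis using prob[OF g p n] weightsD(1)[OF g p] by simp
  next
    case True
    let ?G = "\<Sum>j=1..N. g j" and ?P = "\<lambda>p. measure_pmf.prob (r g) {A. A n = p}"
    have le: "g q / ?G \<le> ?P q" if "q \<in> {1..N}" for q
      using prob[OF g that n] weightsD(1)[OF g that] by (cases "g q = 0") auto
    have "(\<Sum>q=1..N. ?P q) = measure_pmf.prob (r g) (\<Union>q\<in>{1..N}. {A. A n = q})"
      by (subst measure_pmf.finite_measure_finite_Union) (auto simp: disjoint_family_on_def)
    also have "\<dots> \<le> 1" by simp
    also have "1 = (\<Sum>q=1..N. g q / ?G)"
      using weightsD(2)[OF g] by (simp flip: sum_divide_distrib)
    finally have "(\<Sum>q=1..N. ?P q - g q / ?G) \<le> 0"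
      by (simp add: sum_subtractf)
    moreover have "?P p - g p / ?G \<le> (\<Sum>q=1..N. ?P q - g q / ?G)"
      using p le by (intro member_le_sum) auto
    ultimately show ?thesis using le[OF p] by linarith
  qed
  have set: "set_pmf (R p n g) \<subseteq> {A \<in> ancestors N. A n = p}"
    if g: "g \<in> weights N" and p: "p \<in> {1..N}" and n: "n \<in> {1..N}" for g p n
  proof (cases "g p = 0")
    case False
    then have pos: "g p > 0" using weightsD(1)[OF g p] by simp
    then have "measure_pmf.prob (r g) {A. A n = p} \<noteq> 0"
      using prob[OF g p n] weightsD(2)[OF g] by simp
    then have "set_pmf (r g) \<inter> {A. A n = p} \<noteq> {}"
      by (simp add: measure_pmf_zero_iff)
    then show ?thesis
      using cond[OF g p n pos] r[OF g] by (auto simp: set_cond_pmf)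
  qed (use zero[OF g p n] in auto)
  have "measure_pmf.prob (R p n g) {A. A n = p} = 1"
    if "g \<in> weights N" "p \<in> {1..N}" "n \<in> {1..N}" for g p n
    using set[OF that] by (subst measure_pmf.prob_eq_1) (auto simp: AE_measure_pmf_iff)
  moreover have "pmf (R p n g) a = \<P>(A in r g. (\<forall>m\<in>{1..N} - {n}. A m = a m) \<bar> A n = p)"
    if g: "g \<in> weights N" and p: "p \<in> {1..N}" and n: "n \<in> {1..N}"
      and pos: "measure_pmf.prob (r g) {A. A n = p} > 0" and a: "a \<in> ancestors N" "a n = p" for g p n a
  proof -
    have "g p > 0"
      using pos prob'[OF g p n] weightsD(2)[OF g] by (simp add: zero_less_divide_iff)
    moreover have "set_pmf (r g) \<inter> {A. A n = p} \<noteq> {}"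
      using pos by (metis measure_pmf_zero_iff less_irrefl)
    ultimately have "pmf (R p n g) a = pmf (r g) a / measure_pmf.prob (r g) {A. A n = p}"
      using cond[OF g p n] a(2) by (simp add: pmf_cond)
    \<comment> \<open>Within \<open>ancestors N\<close> the entries other than \<open>n\<close>
      together with \<open>A n = p\<close> determine the tuple, so the two events differ by a null
      set.\<close>
    moreover have "measure_pmf.prob (r g) {A. (\<forall>m\<in>{1..N} - {n}. A m = a m) \<and> A n = p} =
        measure_pmf.prob (r g) {a}"
    proof (rule measure_prob_cong_0)
      fix A assume A: "A \<in> {A. (\<forall>m\<in>{1..N} - {n}. A m = a m) \<and> A n = p} - {a}"
      have "A \<notin> ancestors N"
      proof
        assume "A \<in> ancestors N"
        then have "A = a"
          using A a unfolding ancestors_def by (intro PiE_ext[of A "{1..N}" _ a]) auto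
        with A show False by simp
      qed
      then show "pmf (r g) A = 0" using r[OF g] by (auto simp: pmf_eq_0_set_pmf)
    qed (use a in auto)
    ultimately show ?thesis
      by (simp add: cond_prob_def measure_pmf_single)
  qed
  moreover have "is_cond_scheme N R"
    using set by (fastforce simp: is_cond_scheme_def is_scheme_def)
  ultimately show ?thesis
    using assms(1) prob' unfolding valid_def by (intro conjI exI[of _ r]) auto
qed

subsection \<open>Killing\<close>

text \<open>The law of entry \<open>m\<close> alone, with the inner sum of \<open>kill_mass\<close>
  collapsed to its single nonzero term; it represents that sum only for \<open>x\<close> in
  \<open>{1..N}\<close>.\<close>

definition kill_entry :: "nat \<Rightarrow> (nat \<Rightarrow> real) \<Rightarrow> nat \<Rightarrow> nat \<Rightarrow> real" where
  "kill_entry N g m x = of_bool (x = m) * (g m / max_weight N g) +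
    (1 - g m / max_weight N g) * (g x / (\<Sum>l=1..N. g l))"

lemma sum_of_bool_eq:
  "finite S \<Longrightarrow> x \<in> S \<Longrightarrow> (\<Sum>j\<in>S. of_bool (x = j) * f j) = (f x :: 'a :: semiring_1)"
  by (subst sum.remove[of S x]) (auto intro!: sum.neutral)

lemma kill_mass_conv_entry:
  assumes "a \<in> ancestors N"
  shows "kill_mass N g a = (\<Prod>m=1..N. kill_entry N g m (a m))"
proof -
  have "(\<Sum>j=1..N. of_bool (a m = j) * (g j / (\<Sum>l=1..N. g l))) = g (a m) / (\<Sum>l=1..N. g l)"
    if "m \<in> {1..N}" for m
    using assms that by (intro sum_of_bool_eq) (auto simp: ancestors_def)
  then show ?thesis
    using assms by (simp only: kill_mass_def kill_entry_def if_True cong: prod.cong)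
qed

lemma sum_kill_entry:
  assumes "g \<in> weights N" "m \<in> {1..N}"
  shows "(\<Sum>x=1..N. kill_entry N g m x) = 1"
proof -
  have "(\<Sum>x=1..N. of_bool (x = m) * (g m / max_weight N g)) = g m / max_weight N g"
    by (subst sum.remove[OF _ assms(2)]) (auto intro!: sum.neutral)
  moreover have "(\<Sum>x=1..N. (1 - g m / max_weight N g) * (g x / (\<Sum>l=1..N. g l))) =
      1 - g m / max_weight N g"
    using weightsD(2)[OF assms(1)] unfolding sum_distrib_left[symmetric] sum_divide_distrib[symmetric] by simp
  ultimately show ?thesis
    unfolding kill_entry_def sum.distrib by simp
qed

lemma set_kill: "g \<in> weights N \<Longrightarrow> set_pmf (kill N g) \<subseteq> ancestors N"
  by (auto simp: set_pmf_eq pmf_kill kill_mass_def split: if_splits)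

lemma fun_upd_ancestors:
  "A \<in> ancestors N \<Longrightarrow> J \<in> {1..N} \<Longrightarrow> x \<in> {1..N} \<Longrightarrow> A(J := x) \<in> ancestors N"
  unfolding ancestors_def by (auto simp: PiE_iff extensional_def)

text \<open>The entries are independent: overwriting entry \<open>J\<close> sums its factor out of
  the product, and multiplying by the factor at \<open>i\<close> restores the full mass of
  \<open>B\<close>.\<close>

lemma prob_kill_overwrite:
  assumes g: "g \<in> weights N" and J: "J \<in> {1..N}" and i: "i \<in> {1..N}"
  shows "measure_pmf.prob (kill N g) {A. A(J := i) = B} * kill_entry N g J i =
    of_bool (B J = i) * pmf (kill N g) B"
proof (cases "B \<in> ancestors N \<and> B J = i")
  case False
  have "measure_pmf.prob (kill N g) {A. A(J := i) = B} = 0"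
    using False set_kill[OF g] fun_upd_ancestors[OF _ J i]
    by (subst measure_pmf_zero_iff) auto
  moreover have "B \<notin> ancestors N \<Longrightarrow> pmf (kill N g) B = 0"
    by (simp add: pmf_kill[OF g] kill_mass_def)
  ultimately show ?thesis using False by auto
next
  case True
  let ?f = "kill_entry N g" and ?P = "\<Prod>m\<in>{1..N} - {J}. kill_entry N g m (B m)"
  have mass: "pmf (kill N g) (B(J := x)) = ?f J x * ?P" if "x \<in> {1..N}" for x
  proof -
    have "pmf (kill N g) (B(J := x)) = (\<Prod>m=1..N. ?f m ((B(J := x)) m))"
      using fun_upd_ancestors[of B N J x] True J that
      by (simp add: pmf_kill[OF g] kill_mass_conv_entry)
    also have "\<dots> = ?f J x * ?P"
      using J by (subst prod.remove[of _ J]) (auto intro!: prod.cong)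
    finally show ?thesis .
  qed
  have inj: "inj_on (\<lambda>x. B(J := x)) {1..N}"
    by (auto simp: inj_on_def dest: fun_upd_eqD)
  \<comment> \<open>Up to null tuples outside \<open>ancestors N\<close>, the tuples that become
    \<open>B\<close> are those obtained from \<open>B\<close> by letting entry \<open>J\<close> vary
    over \<open>{1..N}\<close>.\<close>
  have "measure_pmf.prob (kill N g) {A. A(J := i) = B} =
      measure_pmf.prob (kill N g) ((\<lambda>x. B(J := x)) ` {1..N})"
  proof (rule measure_prob_cong_0)
    fix A assume A: "A \<in> {A. A(J := i) = B} - (\<lambda>x. B(J := x)) ` {1..N}"
    then have "A = B(J := A J)" by auto
    then have "A \<notin> ancestors N" using A J by (auto simp: ancestors_def PiE_iff)
    then show "pmf (kill N g) A = 0" by (simp add: pmf_kill[OF g] kill_mass_def)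
  next
    fix A assume "A \<in> (\<lambda>x. B(J := x)) ` {1..N} - {A. A(J := i) = B}"
    then show "pmf (kill N g) A = 0" using True by auto
  qed
  also have "\<dots> = (\<Sum>x=1..N. ?f J x * ?P)"
    using inj by (subst measure_measure_pmf_finite) (auto simp: sum.reindex mass)
  also have "\<dots> = ?P"
    using sum_kill_entry[OF g J] by (simp flip: sum_distrib_right)
  finally show ?thesis
    using mass[of i] True i by (auto simp: fun_upd_idem)
qed

text \<open>This explains the law of \<open>J\<close> in the algorithm: it is the posterior of a
  uniform index given that its killed entry equals \<open>i\<close>, the event having probability
  \<open>g i\<close> over the total weight.\<close>

lemma kill_index_mass_eq:
  assumes g: "g \<in> weights N" and i: "i \<in> {1..N}" and J: "J \<in> {1..N}"
  shows "kill_index_mass N i g J * (g i / (\<Sum>j=1..N. g j)) = kill_entry N g J i / N"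
proof (cases "J = i")
  case True
  have sum: "(\<Sum>l\<in>{1..N} - {i}. g l) = (\<Sum>j=1..N. g j) - g i"
    using i by (simp add: sum_diff1)
  show ?thesis
    unfolding True kill_index_mass_def kill_entry_def sum
    using i weightsD(2,3,5)[OF g] by (simp add: field_simps)
next
  case False
  then show ?thesis
    using J by (simp add: kill_index_mass_def kill_entry_def)
qed

text \<open>The tuple and the index are drawn independently, so the index may be drawn first and the
  overwriting done conditionally on it.\<close>

lemma cond_kill_conv_map:
  "cond_kill N i k g = map_pmf (\<lambda>(A, J). rotate_tuple N (int (shift N (- int k) J)) A)
    (kill_index N i g \<bind> (\<lambda>J. map_pmf (\<lambda>A. (A(J := i), J)) (kill N g)))"
  unfolding cond_kill_def Let_def rotate_tuple_def
  by (subst bind_commute_pmf) (simp add: map_pmf_def bind_assoc_pmf bind_return_pmf)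

text \<open>Bayes' rule in the form that \<open>rotated_pmf_cond\<close> expects:
  \<open>kill_index_mass_eq\<close> supplies the factor of entry \<open>J\<close> at
  \<open>i\<close>, and \<open>prob_kill_overwrite\<close> absorbs it.\<close>

lemma pmf_kill_overwrite:
  assumes g: "g \<in> weights N" and i: "i \<in> {1..N}"
  shows "pmf (kill_index N i g \<bind> (\<lambda>J. map_pmf (\<lambda>A. (A(J := i), J)) (kill N g))) (B, J) *
      (g i / (\<Sum>j=1..N. g j)) =
    of_bool (B J = i) * (pmf (kill N g) B * (of_bool (J \<in> {1..N}) / N))"
proof -
  let ?K = "kill N g"
  have "pmf (kill_index N i g \<bind> (\<lambda>J. map_pmf (\<lambda>A. (A(J := i), J)) ?K)) (B, J) =
      (\<Sum>J'=1..N. pmf (map_pmf (\<lambda>A. (A(J' := i), J')) ?K) (B, J) * pmf (kill_index N i g) J')"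
    unfolding pmf_bind using i
    by (subst integral_measure_pmf_real[of "{1..N}"])
       (auto simp: set_pmf_eq pmf_kill_index[OF g i] kill_index_mass_def split: if_splits)
  also have "\<dots> = (\<Sum>J'=1..N. of_bool (J = J') *
      (measure_pmf.prob ?K {A. A(J' := i) = B} * kill_index_mass N i g J'))"
    by (intro sum.cong) (auto simp: pmf_map vimage_def pmf_kill_index[OF g i])
  also have "\<dots> = of_bool (J \<in> {1..N}) *
      (measure_pmf.prob ?K {A. A(J := i) = B} * kill_index_mass N i g J)"
    by (cases "J \<in> {1..N}") (auto simp: sum_of_bool_eq intro!: sum.neutral)
  finally have *: "pmf (kill_index N i g \<bind> (\<lambda>J. map_pmf (\<lambda>A. (A(J := i), J)) ?K)) (B, J) = \<dots>" .
  show ?thesis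
  proof (cases "J \<in> {1..N}")
    case True
    then have "of_bool (J \<in> {1..N}) * (measure_pmf.prob ?K {A. A(J := i) = B} * kill_index_mass N i g J) *
        (g i / (\<Sum>j=1..N. g j)) =
        measure_pmf.prob ?K {A. A(J := i) = B} * (kill_index_mass N i g J * (g i / (\<Sum>j=1..N. g j)))"
      by simp
    also have "\<dots> = of_bool (B J = i) * pmf ?K B / N"
      unfolding kill_index_mass_eq[OF g i True] prob_kill_overwrite[OF g True i, symmetric] by simp
    finally show ?thesis
      unfolding * using True by simp
  next
    case False
    then have "of_bool (J \<in> {1..N}) = (0 :: real)" by simp
    then show ?thesis unfolding * by (simp only: mult_zero_left mult_zero_right div_0)
  qed
qed

text \<open>Read off the algorithm directly, so that it also covers \<open>g i = 0\<close>, where no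
  conditional law is available: entry \<open>J\<close> is set to \<open>i\<close> and then brought
  to position \<open>k\<close>.\<close>

lemma set_cond_kill:
  assumes g: "g \<in> weights N" and i: "i \<in> {1..N}" and k: "k \<in> {1..N}"
  shows "set_pmf (cond_kill N i k g) \<subseteq> {A \<in> ancestors N. A k = i}"
proof -
  have "J \<in> {1..N}" if "J \<in> set_pmf (kill_index N i g)" for J
    using that by (auto simp: set_pmf_eq pmf_kill_index[OF g i] kill_index_mass_def split: if_splits)
  moreover have "N > 0" using i by auto
  ultimately show ?thesis
    unfolding cond_kill_conv_map using set_kill[OF g] k i
    by (auto simp: rotate_tuple_at[simplified] intro!: rotate_tuple_ancestors fun_upd_ancestors)
qed

lemma valid_cond_kill:
  assumes "N > 0"
  shows "valid N (cond_kill N)"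
proof (rule validI[where r = "\<lambda>g. rotated_pmf N (kill N g)"])
  show "is_scheme N (\<lambda>g. rotated_pmf N (kill N g))"
    using set_rotated_pmf[OF assms set_kill] by (auto simp: is_scheme_def)
next
  fix g p n assume g: "g \<in> weights N" and p: "p \<in> {1..N}" and n: "n \<in> {1..N}" and pos: "g p > 0"
  have "g p / (\<Sum>j=1..N. g j) > 0"
    using pos weightsD(2)[OF g] by simp
  note * = rotated_pmf_cond[OF pmf_kill_overwrite[OF g p] this n]
  show "measure_pmf.prob (rotated_pmf N (kill N g)) {A. A n = p} = g p / (\<Sum>j=1..N. g j)"
    by (rule *)
  show "cond_kill N p n g = cond_pmf (rotated_pmf N (kill N g)) {A. A n = p}"
    unfolding cond_kill_conv_map by (rule *)
qed (rule set_cond_kill)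

subsection \<open>Systematic resampling\<close>

lemma order_cdf_mono:
  assumes "\<And>j. j \<in> {1..N} \<Longrightarrow> 0 \<le> W (\<pi> j)" "a \<le> b" "b \<le> N"
  shows "order_cdf W \<pi> a \<le> order_cdf W \<pi> b"
  unfolding order_cdf_def using assms(2,3) by (intro sum_mono2 assms(1)) auto

lemma order_quantile_eq:
  assumes nonneg: "\<And>j. j \<in> {1..N} \<Longrightarrow> 0 \<le> W (\<pi> j)"
    and m: "m \<in> {1..N}" "order_cdf W \<pi> (m - 1) < u" "u \<le> order_cdf W \<pi> m"
  shows "order_quantile N W \<pi> u = m"
  unfolding order_quantile_def
proof (rule the_equality)
  fix k assume k: "k \<in> {1..N} \<and> order_cdf W \<pi> (k - 1) < u \<and> u \<le> order_cdf W \<pi> k"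
  have "\<not> k \<le> m - 1"
    using order_cdf_mono[of N W \<pi> k "m - 1", OF nonneg] m k by force
  moreover have "\<not> m \<le> k - 1"
    using order_cdf_mono[of N W \<pi> m "k - 1", OF nonneg] m k by force
  ultimately show "k = m" by linarith
qed (use m in simp)

text \<open>A rotated order is a bijection of \<open>{1..N}\<close> but need not fix the other
  indices, as \<open>permutes\<close> demands. Redefining it as the identity outside
  \<open>{1..N}\<close> leaves the relevant partial sums unchanged.\<close>

lemma order_quantile_spec:
  assumes "\<And>j. j \<in> {1..N} \<Longrightarrow> 0 \<le> W j" "(\<Sum>j=1..N. W j) = 1"
    and \<pi>: "bij_betw \<pi> {1..N} {1..N}" and "0 < u" "u < 1"
  shows "order_quantile N W \<pi> u \<in> {1..N}"
    "order_cdf W \<pi> (order_quantile N W \<pi> u - 1) < u"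
    "u \<le> order_cdf W \<pi> (order_quantile N W \<pi> u)"
proof -
  define \<pi>' where "\<pi>' j = (if j \<in> {1..N} then \<pi> j else j)" for j
  have "bij_betw \<pi>' {1..N} {1..N}"
    using \<pi> by (subst bij_betw_cong[of _ _ \<pi>]) (auto simp: \<pi>'_def)
  then have "\<pi>' permutes {1..N}"
    by (rule bij_imp_permutes) (auto simp: \<pi>'_def)
  from order_quantile_correct[OF assms(1,2) this assms(4,5)]
  obtain m where m: "m \<in> {1..N}" "order_cdf W \<pi>' (m - 1) < u" "u \<le> order_cdf W \<pi>' m"
    by blast
  have cdf: "order_cdf W \<pi>' k = order_cdf W \<pi> k" if "k \<le> N" for k
    using that unfolding order_cdf_def by (intro sum.cong) (auto simp: \<pi>'_def)
  have nonneg: "0 \<le> W (\<pi> j)" if "j \<in> {1..N}" for j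
    using assms(1) bij_betwE[OF \<pi>] that by blast
  have "order_cdf W \<pi> (m - 1) < u" "u \<le> order_cdf W \<pi> m"
    using m cdf[of m] cdf[of "m - 1"] by auto
  then show "order_quantile N W \<pi> u \<in> {1..N}"
    "order_cdf W \<pi> (order_quantile N W \<pi> u - 1) < u"
    "u \<le> order_cdf W \<pi> (order_quantile N W \<pi> u)"
    using m(1) order_quantile_eq[of N W \<pi>, OF nonneg m(1)] by auto
qed

lemma systematic_argument_bounds:
  assumes "j \<in> {1..N}" "0 < u" "u < 1"
  shows "0 < (real j - 1 + u) / N" "(real j - 1 + u) / N < 1"
proof -
  have "1 \<le> real j" "real j \<le> real N" using assms(1) by auto
  then show "0 < (real j - 1 + u) / N" "(real j - 1 + u) / N < 1"
    using assms by (auto simp: field_simps)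
qed

lemma systematic_ancestors:
  assumes "\<And>j. j \<in> {1..N} \<Longrightarrow> 0 \<le> W j" "(\<Sum>j=1..N. W j) = 1"
    and \<pi>: "bij_betw \<pi> {1..N} {1..N}" and u: "0 < u" "u < 1"
  shows "systematic N W \<pi> u \<in> ancestors N"
proof -
  have "\<pi> (order_quantile N W \<pi> ((real j - 1 + u) / N)) \<in> {1..N}" if "j \<in> {1..N}" for j
    using order_quantile_spec(1)[OF assms(1-3) systematic_argument_bounds[OF that u]] bij_betwE[OF \<pi>] by blast
  then show ?thesis
    unfolding systematic_def ancestors_def by auto
qed

text \<open>The first cell of the order reaches from 0 to \<open>W (\<pi> 1)\<close>, and
  injectivity of \<open>\<pi>\<close> excludes all other cells. Hence the indices that choose
  \<open>\<pi> 1\<close> form an initial block.\<close>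

lemma systematic_eq_first_iff:
  assumes "\<And>j. j \<in> {1..N} \<Longrightarrow> 0 \<le> W j" "(\<Sum>j=1..N. W j) = 1"
    and \<pi>: "bij_betw \<pi> {1..N} {1..N}" and u: "0 < u" "u < 1" and j: "j \<in> {1..N}"
  shows "systematic N W \<pi> u j = \<pi> 1 \<longleftrightarrow> real j - 1 + u \<le> N * W (\<pi> 1)"
proof -
  define v where "v = (real j - 1 + u) / N"
  note v = systematic_argument_bounds[OF j u, folded v_def]
  note Q = order_quantile_spec[OF assms(1-3) v]
  have nonneg: "0 \<le> W (\<pi> j)" if "j \<in> {1..N}" for j
    using assms(1) bij_betwE[OF \<pi>] that by blast
  have 1: "1 \<in> {1..N}" using j by auto
  have "systematic N W \<pi> u j = \<pi> 1 \<longleftrightarrow> order_quantile N W \<pi> v = 1"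
    using j bij_betw_imp_inj_on[OF \<pi>] Q(1) 1 unfolding systematic_def v_def
    by (auto dest: inj_onD)
  also have "\<dots> \<longleftrightarrow> v \<le> W (\<pi> 1)"
    using Q(3) order_quantile_eq[of N W \<pi> 1 v, OF nonneg 1] v(1) by (auto simp: order_cdf_def)
  also have "\<dots> \<longleftrightarrow> real j - 1 + u \<le> N * W (\<pi> 1)"
    using j unfolding v_def by (simp add: field_simps)
  finally show ?thesis .
qed

section \<open>Changing the start of the order\<close>

lemma order_cdf_top:
  assumes "(\<Sum>j=1..N. W j) = 1" "bij_betw \<pi> {1..N} {1..N}"
  shows "order_cdf W \<pi> N = 1"
  using sum.reindex_bij_betw[OF assms(2), of W] assms(1) by (simp add: order_cdf_def)

text \<open>A partial sum over a cyclic window that starts behind \<open>t\<close>: a window passing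
  \<open>N\<close> has collected \<open>1 - order_cdf W \<pi> t\<close> up to the wrap and then
  restarts at the front.\<close>

lemma order_cdf_rotate:
  assumes "order_cdf W \<pi> N = 1" "t < N" "x \<le> N"
  shows "order_cdf W (\<lambda>j. \<pi> (shift N (int t) j)) x =
    (if t + x \<le> N then order_cdf W \<pi> (t + x) - order_cdf W \<pi> t
     else 1 - order_cdf W \<pi> t + order_cdf W \<pi> (t + x - N))"
  using assms(3)
proof (induction x)
  case 0
  then show ?case using assms(2) by (simp add: order_cdf_def)
next
  case (Suc x)
  have Suc': "order_cdf W \<rho> (Suc k) = order_cdf W \<rho> k + W (\<rho> (Suc k))" for \<rho> k
    by (simp add: order_cdf_def)
  have shift: "shift N (int t) (Suc x) = (if Suc x + t \<le> N then Suc x + t else Suc x + t - N)"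
    using Suc.prems assms(2) by (intro shift_nat) auto
  consider "t + Suc x \<le> N" | "t + x = N" | "t + x > N" by linarith
  then show ?case
  proof cases
    case 1
    then show ?thesis
      using Suc by (simp add: Suc' shift add.commute)
  next
    \<comment> \<open>The window has just reached \<open>N\<close>, so the next summand is the first
      weight of the order.\<close>
    case 2
    then have "Suc x + t - N = Suc 0" "t + Suc x - N = Suc 0" by auto
    then show ?thesis
      using Suc 2 assms(1) by (simp add: Suc' shift del: One_nat_def) (simp add: order_cdf_def)
  next
    case 3
    then have "t + Suc x - N = Suc (t + x - N)" "Suc x + t - N = Suc (t + x - N)" by auto
    then show ?thesis
      using Suc 3 by (simp add: Suc' shift)
  qed
qed

text \<open>
  Starting the order at position \<open>t + 1\<close> moves the grid by \<open>order_cdf W \<pi> t\<close> modulo 1; the integral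
  part \<open>c\<close> of the shift, in units of the grid width, permutes the grid points cyclically.
\<close>

lemma systematic_rotate:
  assumes W: "\<And>j. j \<in> {1..N} \<Longrightarrow> 0 \<le> W j" "(\<Sum>j=1..N. W j) = 1"
    and \<pi>: "bij_betw \<pi> {1..N} {1..N}" and t: "t < N" and c: "c \<le> N"
    and u: "0 < u" "u < 1" and u': "0 < u'" "u' < 1"
    and eq: "N * order_cdf W \<pi> t + u = real c + u'"
  shows "systematic N W (\<lambda>j. \<pi> (shift N (int t) j)) u = rotate_tuple N (int c) (systematic N W \<pi> u')"
proof -
  let ?\<pi>' = "\<lambda>j. \<pi> (shift N (int t) j)"
  let ?F = "order_cdf W \<pi>"
  have N: "N > 0" using t by auto
  have nonneg: "0 \<le> W (\<pi> j)" if "j \<in> {1..N}" for j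
    using W(1) bij_betwE[OF \<pi>] that by blast
  have nonneg': "0 \<le> W (?\<pi>' j)" if "j \<in> {1..N}" for j
    using nonneg shift_in[OF N] by blast
  note cdf' = order_cdf_rotate[OF order_cdf_top[OF W(2) \<pi>] t]
  have "?\<pi>' (order_quantile N W ?\<pi>' ((real j - 1 + u) / N)) =
      \<pi> (order_quantile N W \<pi> ((real (shift N (int c) j) - 1 + u') / N))" if j: "j \<in> {1..N}" for j
  proof -
    define j' where "j' = shift N (int c) j"
    define w where "w = (real j' - 1 + u') / N"
    define v where "v = (real j - 1 + u) / N"
    define m where "m = order_quantile N W \<pi> w"
    have j': "j' \<in> {1..N}" unfolding j'_def by (rule shift_in[OF N])
    note w = systematic_argument_bounds[OF j' u', folded w_def]
    note v = systematic_argument_bounds[OF j u, folded v_def]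
    note m = order_quantile_spec[OF W \<pi> w, folded m_def]
    have v_eq: "v + ?F t = (real j + real c - 1 + u') / N"
      using eq N unfolding v_def by (simp add: field_simps)
    \<comment> \<open>The cell of the rotated order that contains \<open>v\<close> should be the
      position \<open>m'\<close> that the rotation sends to \<open>m\<close>; containing
      \<open>v\<close> then determines the quantile.\<close>
    have "\<exists>m'\<in>{1..N}. shift N (int t) m' = m \<and> order_cdf W ?\<pi>' (m' - 1) < v \<and> v \<le> order_cdf W ?\<pi>' m'"
    proof (cases "j + c \<le> N")
      case True
      then have "w = v + ?F t"
        using j c unfolding v_eq w_def j'_def by (simp add: shift_nat)
      \<comment> \<open>Because \<open>0 < v\<close>, the value \<open>?F t\<close> lies strictly
        below \<open>w\<close>, while \<open>w \<le> ?F m\<close>.\<close>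
      then have "t < m"
        using v(1) m order_cdf_mono[of N W \<pi> m t, OF nonneg] t by (force simp: not_less[symmetric])
      then have m': "m - t \<in> {1..N}" "t + (m - t) = m" "t + (m - t - 1) = m - 1" "t + (m - t) \<le> N"
        "t + (m - t - 1) \<le> N"
        using m(1) by auto
      show ?thesis
      proof (intro bexI[of _ "m - t"] conjI)
        show "shift N (int t) (m - t) = m"
          using m' t by (subst shift_nat) auto
        show "order_cdf W ?\<pi>' (m - t - 1) < v" "v \<le> order_cdf W ?\<pi>' (m - t)"
          using m m' \<open>w = v + ?F t\<close> cdf'[of "m - t"] cdf'[of "m - t - 1"] by auto
      qed (rule m')
    next
      case False
      then have "w = v + ?F t - 1"
        using j c N unfolding v_eq w_def j'_def by (simp add: shift_nat of_nat_diff field_simps)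
      \<comment> \<open>Because \<open>v < 1\<close>, now \<open>?F (m - 1) < w < ?F t\<close>: the
        cell of \<open>m\<close> lies before the new start.\<close>
      then have "\<not> t \<le> m - 1"
        using v(2) m order_cdf_mono[of N W \<pi> t "m - 1", OF nonneg] by force
      then have m': "m + N - t \<in> {1..N}" "t + (m + N - t) - N = m" "\<not> t + (m + N - t) \<le> N"
        using m(1) t by auto
      show ?thesis
      proof (intro bexI[of _ "m + N - t"] conjI)
        show "shift N (int t) (m + N - t) = m"
          using m' t by (subst shift_nat) auto
        show "v \<le> order_cdf W ?\<pi>' (m + N - t)"
          using m m' \<open>w = v + ?F t - 1\<close> cdf'[of "m + N - t"] by auto
        \<comment> \<open>For \<open>m = 1\<close> the predecessor position \<open>N - t\<close> has
          not wrapped yet, but \<open>?F N = 1\<close> and \<open>?F 0 = 0\<close> give the same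
          formula.\<close>
        have "order_cdf W ?\<pi>' (m + N - t - 1) = 1 - ?F t + ?F (m - 1)"
        proof (cases "m = 1")
          case True
          then have "t + (m + N - t - 1) = N" using t by auto
          then show ?thesis
            using True m' cdf'[of "m + N - t - 1"] order_cdf_top[OF W(2) \<pi>]
            by (simp add: order_cdf_def)
        next
          case False
          then have "t + (m + N - t - 1) - N = m - 1" "\<not> t + (m + N - t - 1) \<le> N"
            using m(1) t by auto
          then show ?thesis
            using m' cdf'[of "m + N - t - 1"] by auto
        qed
        then show "order_cdf W ?\<pi>' (m + N - t - 1) < v"
          using m \<open>w = v + ?F t - 1\<close> by simp
      qed (rule m')
    qed
    then obtain m' where m': "m' \<in> {1..N}" "shift N (int t) m' = m"
      "order_cdf W ?\<pi>' (m' - 1) < v" "v \<le> order_cdf W ?\<pi>' m'" by blast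
    have "order_quantile N W ?\<pi>' v = m'"
      using nonneg' m'(1,3,4) by (rule order_quantile_eq)
    then show ?thesis
      using m'(2) unfolding v_def w_def m_def j'_def by simp
  qed
  then show ?thesis
    using shift_in[OF N] unfolding systematic_def rotate_tuple_def
    by (auto simp: fun_eq_iff restrict_def)
qed

section \<open>The systematic law through Lebesgue measure\<close>

lemma measurable_systematic [measurable]: "systematic N W \<pi> \<in> measurable borel (count_space UNIV)"
proof -
  define S where "S = {1..N} \<rightarrow>\<^sub>E range \<pi>"
  have S: "countable S" "systematic N W \<pi> u \<in> S" for u
    unfolding S_def by (auto intro!: countable_PiE simp: systematic_def)
  have "{u. systematic N W \<pi> u = a} \<in> sets borel" if "a \<in> S" for a
  proof -
    have "{u. systematic N W \<pi> u = a} =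
        {u \<in> space borel. \<forall>j\<in>{1..N}. \<pi> (order_quantile N W \<pi> ((real j - 1 + u) / N)) = a j}"
      using that unfolding S_def systematic_def
      by (auto simp: PiE_iff extensional_def restrict_def fun_eq_iff)
    also have "\<dots> \<in> sets borel"
      by measurable
    finally show ?thesis .
  qed
  then have "systematic N W \<pi> \<in> measurable borel (count_space S)"
    using S by (subst measurable_count_space_eq_countable) (auto simp: vimage_def)
  then show ?thesis
    using measurable_compose[of "systematic N W \<pi>" borel "count_space S" "\<lambda>a. a" "count_space UNIV"]
    by simp
qed

lemma sets_vimage_systematic: "{u. systematic N W \<pi> u \<in> X} \<in> sets borel"
  using measurable_sets[OF measurable_systematic, of X N W \<pi>] by (simp add: vimage_def)

lemma prob_systematic_pmf:
  assumes "lo < hi"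
  shows "measure_pmf.prob (systematic_pmf N W \<pi> lo hi) X =
    measure lborel {u \<in> {lo<..<hi}. systematic N W \<pi> u \<in> X} / (hi - lo)"
proof -
  let ?U = "uniform_measure lborel {lo<..<hi}"
  have "measure_pmf.prob (systematic_pmf N W \<pi> lo hi) X = measure ?U {u. systematic N W \<pi> u \<in> X}"
    unfolding measure_systematic_pmf[OF assms]
    by (subst measure_distr) (auto simp: vimage_def cong: measurable_cong_sets)
  also have "\<dots> = measure lborel ({lo<..<hi} \<inter> {u. systematic N W \<pi> u \<in> X}) / measure lborel {lo<..<hi}"
    using sets_vimage_systematic assms by (intro measure_uniform_measure) auto
  also have "{lo<..<hi} \<inter> {u. systematic N W \<pi> u \<in> X} = {u \<in> {lo<..<hi}. systematic N W \<pi> u \<in> X}"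
    by auto
  finally show ?thesis using assms by simp
qed

text \<open>A tuple of positive probability has a nonempty preimage, which gives an actual offset
  \<open>u\<close> to argue with pointwise.\<close>

lemma set_systematic_pmf:
  assumes "lo < hi"
  shows "set_pmf (systematic_pmf N W \<pi> lo hi) \<subseteq> systematic N W \<pi> ` {lo<..<hi}"
proof
  fix a assume "a \<in> set_pmf (systematic_pmf N W \<pi> lo hi)"
  then have "measure_pmf.prob (systematic_pmf N W \<pi> lo hi) {a} \<noteq> 0"
    by (simp add: measure_pmf_single set_pmf_iff)
  then have "{u \<in> {lo<..<hi}. systematic N W \<pi> u \<in> {a}} \<noteq> {}"
    unfolding prob_systematic_pmf[OF assms] by (rule contrapos_nn) (simp only: measure_empty div_0)
  then show "a \<in> systematic N W \<pi> ` {lo<..<hi}" by auto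
qed

lemma systematic_pmf_split:
  assumes "lo < mid" "mid < hi"
  shows "systematic_pmf N W \<pi> lo hi = bernoulli_pmf ((mid - lo) / (hi - lo)) \<bind>
    (\<lambda>b. if b then systematic_pmf N W \<pi> lo mid else systematic_pmf N W \<pi> mid hi)"
proof (rule pmf_eqI)
  fix a
  define V where "V l h = {u \<in> {l<..<h}. systematic N W \<pi> u = a}" for l h
  have "V l h = {l<..<h} \<inter> {u. systematic N W \<pi> u \<in> {a}}" for l h
    by (auto simp: V_def)
  then have meas: "V l h \<in> sets borel" for l h
    using sets_vimage_systematic[of N W \<pi> "{a}"] by (simp only: sets.Int borel_open open_greaterThanLessThan)
  have p: "pmf (systematic_pmf N W \<pi> l h) a = measure lborel (V l h) / (h - l)" if "l < h" for l h
    using prob_systematic_pmf[OF that, of N W \<pi> "{a}"] by (simp add: measure_pmf_single V_def)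
  have fin: "emeasure lborel (V l h) \<noteq> \<infinity>" for l h
  proof -
    have "bounded (V l h)"
      by (rule bounded_subset[of "cbox l h"]) (auto simp: V_def)
    then show ?thesis using emeasure_bounded_finite by force
  qed
  \<comment> \<open>The point \<open>mid\<close> lies in neither open subinterval, hence equality
    only up to a null set.\<close>
  have "measure lborel (V lo hi) = measure lborel (V lo mid \<union> V mid hi)"
  proof (rule measure_eq_AE)
    show "AE u in lborel. u \<in> V lo hi \<longleftrightarrow> u \<in> V lo mid \<union> V mid hi"
      using AE_lborel_singleton[of mid] by eventually_elim (use assms in \<open>auto simp: V_def\<close>)
  qed (use meas in auto)
  also have "\<dots> = measure lborel (V lo mid) + measure lborel (V mid hi)"
    using fin meas by (intro measure_Union) (auto simp: V_def)
  finally have V: "measure lborel (V lo hi) = measure lborel (V lo mid) + measure lborel (V mid hi)" .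
  have q: "0 \<le> (mid - lo) / (hi - lo)" "(mid - lo) / (hi - lo) \<le> 1"
    using assms by (auto simp: field_simps)
  have "1 - (mid - lo) / (hi - lo) = (hi - mid) / (hi - lo)"
    using assms by (simp add: field_simps)
  then show "pmf (systematic_pmf N W \<pi> lo hi) a = pmf (bernoulli_pmf ((mid - lo) / (hi - lo)) \<bind>
    (\<lambda>b. if b then systematic_pmf N W \<pi> lo mid else systematic_pmf N W \<pi> mid hi)) a"
    using assms q unfolding pmf_bind integral_bernoulli_pmf[OF q]
    by (simp add: p V add_divide_distrib)
qed

text \<open>Translation invariance of Lebesgue measure turns a pointwise identity between offsets
  \<open>u\<close> and \<open>u + d\<close> into one between laws.\<close>

lemma systematic_pmf_rotate:
  assumes "lo < hi"
    and eq: "\<And>u. u \<in> {lo<..<hi} \<Longrightarrow> systematic N W \<pi>' u = rotate_tuple N c (systematic N W \<pi> (u + d))"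
  shows "systematic_pmf N W \<pi>' lo hi = map_pmf (rotate_tuple N c) (systematic_pmf N W \<pi> (lo + d) (hi + d))"
proof (rule pmf_eqI)
  fix a
  define V where "V = {v \<in> {lo + d<..<hi + d}. rotate_tuple N c (systematic N W \<pi> v) = a}"
  have "V = {lo + d<..<hi + d} \<inter> {u. systematic N W \<pi> u \<in> {A. rotate_tuple N c A = a}}"
    by (auto simp: V_def)
  then have V: "V \<in> sets borel"
    using sets_vimage_systematic[of N W \<pi> "{A. rotate_tuple N c A = a}"]
    by (simp only: sets.Int borel_open open_greaterThanLessThan)
  have "pmf (systematic_pmf N W \<pi>' lo hi) a =
      measure lborel {u \<in> {lo<..<hi}. systematic N W \<pi>' u = a} / (hi - lo)"
    using prob_systematic_pmf[OF assms(1), of N W \<pi>' "{a}"] by (simp add: measure_pmf_single)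
  also have "{u \<in> {lo<..<hi}. systematic N W \<pi>' u = a} = (+) d -` V \<inter> space lborel"
    using eq by (auto simp: V_def add.commute)
  also have "measure lborel \<dots> = measure (distr lborel borel ((+) d)) V"
    using V by (subst measure_distr) auto
  also have "\<dots> = measure lborel V"
    by (simp add: lborel_distr_plus)
  also have "measure lborel V / (hi - lo) =
      pmf (map_pmf (rotate_tuple N c) (systematic_pmf N W \<pi> (lo + d) (hi + d))) a"
    using prob_systematic_pmf[of "lo + d" "hi + d" N W \<pi> "rotate_tuple N c -` {a}"] assms(1)
    by (simp add: pmf_map V_def)
  finally show "pmf (systematic_pmf N W \<pi>' lo hi) a =
      pmf (map_pmf (rotate_tuple N c) (systematic_pmf N W \<pi> (lo + d) (hi + d))) a" .
qed

lemma bernoulli_pmf_swap: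
  assumes "0 \<le> q" "q \<le> 1"
  shows "bernoulli_pmf (1 - q) \<bind> (\<lambda>b. if b then M else L) = bernoulli_pmf q \<bind> (\<lambda>b. if b then L else M)"
  using assms by (intro pmf_eqI) (simp add: pmf_bind integral_bernoulli_pmf)

text \<open>Write \<open>N * order_cdf W \<pi> t\<close> as \<open>c + f\<close> with integral part
  \<open>c\<close>. An offset below \<open>1 - f\<close> becomes \<open>u + f\<close> with a
  rotation by \<open>c\<close>, one above becomes \<open>u + f - 1\<close> with a rotation by
  \<open>c + 1\<close>. The uniform shift absorbs both rotations, and the two image intervals make
  up the unit interval again. The bound on \<open>order_cdf\<close> keeps
  \<open>c + 1 \<le> N\<close>.\<close>

lemma rotated_systematic_pmf_order:
  assumes W: "\<And>j. j \<in> {1..N} \<Longrightarrow> 0 \<le> W j" "(\<Sum>j=1..N. W j) = 1"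
    and \<pi>: "bij_betw \<pi> {1..N} {1..N}" and t: "t < N" and less: "order_cdf W \<pi> t < 1"
  shows "rotated_pmf N (systematic_pmf N W (\<lambda>j. \<pi> (shift N (int t) j)) 0 1) =
    rotated_pmf N (systematic_pmf N W \<pi> 0 1)"
proof -
  let ?\<pi>' = "\<lambda>j. \<pi> (shift N (int t) j)"
  define x where "x = N * order_cdf W \<pi> t"
  have N: "N > 0" using t by auto
  have nonneg: "0 \<le> W (\<pi> j)" if "j \<in> {1..N}" for j
    using W(1) bij_betwE[OF \<pi>] that by blast
  have "0 \<le> x" "x < N"
    using order_cdf_mono[of N W \<pi> 0 t, OF nonneg] t less N by (auto simp: x_def order_cdf_def)
  define c where "c = nat \<lfloor>x\<rfloor>"
  define f where "f = x - c"
  have c: "real c \<le> x" "x < real c + 1" "c < N"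
    using \<open>0 \<le> x\<close> \<open>x < N\<close> unfolding c_def by linarith+
  have f: "0 \<le> f" "f < 1" using c by (auto simp: f_def)
  have 1: "systematic_pmf N W ?\<pi>' 0 (1 - f) =
      map_pmf (rotate_tuple N (int c)) (systematic_pmf N W \<pi> (0 + f) (1 - f + f))"
  proof (rule systematic_pmf_rotate)
    fix u assume u: "u \<in> {0<..<1 - f}"
    then show "systematic N W ?\<pi>' u = rotate_tuple N (int c) (systematic N W \<pi> (u + f))"
      using c f by (intro systematic_rotate W \<pi> t) (auto simp: f_def x_def)
  qed (use f in simp)
  show ?thesis
  \<comment> \<open>For \<open>f = 0\<close> one piece of the split would be an empty interval, on
    which \<open>systematic_pmf\<close> has no meaningful value.\<close>
  proof (cases "f = 0")
    case True
    then show ?thesis using 1 by (simp add: rotated_pmf_map_rotate N)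
  next
    case False
    have 2: "systematic_pmf N W ?\<pi>' (1 - f) 1 =
        map_pmf (rotate_tuple N (int (Suc c))) (systematic_pmf N W \<pi> (1 - f + (f - 1)) (1 + (f - 1)))"
    proof (rule systematic_pmf_rotate)
      fix u assume u: "u \<in> {1 - f<..<1}"
      then show "systematic N W ?\<pi>' u = rotate_tuple N (int (Suc c)) (systematic N W \<pi> (u + (f - 1)))"
        using c f by (intro systematic_rotate W \<pi> t) (auto simp: f_def x_def)
    qed (use f False in simp)
    have "systematic_pmf N W ?\<pi>' 0 1 = bernoulli_pmf (1 - f) \<bind>
        (\<lambda>b. if b then systematic_pmf N W ?\<pi>' 0 (1 - f) else systematic_pmf N W ?\<pi>' (1 - f) 1)"
      using systematic_pmf_split[of 0 "1 - f" 1 N W ?\<pi>'] f False by simp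
    then have "rotated_pmf N (systematic_pmf N W ?\<pi>' 0 1) = bernoulli_pmf (1 - f) \<bind>
        (\<lambda>b. if b then rotated_pmf N (systematic_pmf N W \<pi> f 1) else rotated_pmf N (systematic_pmf N W \<pi> 0 f))"
      using 1 2 by (simp add: rotated_pmf_bind rotated_pmf_map_rotate N if_distrib cong: if_cong)
    also have "\<dots> = rotated_pmf N (bernoulli_pmf f \<bind>
        (\<lambda>b. if b then systematic_pmf N W \<pi> 0 f else systematic_pmf N W \<pi> f 1))"
      using f by (simp add: bernoulli_pmf_swap rotated_pmf_bind if_distrib cong: if_cong)
    also have "\<dots> = rotated_pmf N (systematic_pmf N W \<pi> 0 1)"
      using systematic_pmf_split[of 0 f 1 N W \<pi>] f False by simp
    finally show ?thesis .
  qed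
qed

text \<open>With \<open>r = w - n\<close>, an offset below \<open>r\<close> gives the first block
  \<open>n + 1\<close> indices, one above gives it \<open>n\<close>. The probability
  \<open>q\<close> is \<open>r\<close> biased by block size, so dividing by the size in the uniform
  draw leaves \<open>q / (n + 1) * W (\<pi> 1) = r / N\<close> and likewise
  \<open>(1 - r) / N\<close> for \<open>n\<close>: uniform mass on the pairs with
  \<open>A J = \<pi> 1\<close>.\<close>

lemma pmf_systematic_block:
  fixes N :: nat and W :: "nat \<Rightarrow> real" and \<pi> :: "nat \<Rightarrow> nat"
  defines "w \<equiv> N * W (\<pi> 1)" and "n \<equiv> nat \<lfloor>N * W (\<pi> 1)\<rfloor>"
  assumes W: "\<And>j. j \<in> {1..N} \<Longrightarrow> 0 \<le> W j" "(\<Sum>j=1..N. W j) = 1"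
    and \<pi>: "bij_betw \<pi> {1..N} {1..N}" and pos: "W (\<pi> 1) > 0"
  shows "pmf (bernoulli_pmf ((w - n) * (n + 1) / w) \<bind> (\<lambda>b.
        pair_pmf (if b then systematic_pmf N W \<pi> 0 (w - n) else systematic_pmf N W \<pi> (w - n) 1)
          (pmf_of_set {1..if b then n + 1 else n}))) (A, J) * W (\<pi> 1) =
    of_bool (A J = \<pi> 1) * (pmf (systematic_pmf N W \<pi> 0 1) A * (of_bool (J \<in> {1..N}) / N))"
proof -
  define r where "r = w - n"
  let ?S1 = "systematic_pmf N W \<pi> 0 r" and ?S0 = "systematic_pmf N W \<pi> r 1"
  have N: "N > 0" using W(2) by (cases N) auto
  then have "1 \<in> {1..N}" by auto
  then have "\<pi> 1 \<in> {1..N}" using bij_betwE[OF \<pi>] by blast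
  then have "W (\<pi> 1) \<le> 1"
    unfolding W(2)[symmetric] using W(1) by (intro member_le_sum) auto
  then have w: "0 < w" "w \<le> N"
    using pos N by (auto simp: w_def mult_le_cancel_left1)
  have n_eq: "n = nat \<lfloor>w\<rfloor>" by (simp add: n_def w_def)
  have r: "0 \<le> r" "r < 1" "w = n + r"
    using w unfolding r_def n_eq by linarith+
  have first: "systematic N W \<pi> u J = \<pi> 1 \<longleftrightarrow> real J - 1 + u \<le> w"
    if "J \<in> {1..N}" "0 < u" "u < 1" for u
    unfolding w_def using that by (intro systematic_eq_first_iff W \<pi>)
  have S0: "A J = \<pi> 1 \<longleftrightarrow> J \<le> n" if A: "A \<in> set_pmf ?S0" and J: "J \<in> {1..N}"
  proof -
    obtain u where u: "A = systematic N W \<pi> u" "r < u" "u < 1"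
      using subsetD[OF set_systematic_pmf[OF r(2)] A] by auto
    then have "A J = \<pi> 1 \<longleftrightarrow> real J - 1 + u \<le> w"
      using r J by (simp only: first)
    also have "\<dots> \<longleftrightarrow> J \<le> n"
      using u r by linarith
    finally show ?thesis .
  qed
  show ?thesis
  \<comment> \<open>For \<open>r = 0\<close> the law \<open>?S1\<close> lives on an empty interval
    and is unspecified, but its branch has probability 0.\<close>
  proof (cases "r = 0")
    case True
    then have "n > 0" "n \<le> N" using w r by auto
    then have unif: "pmf (pmf_of_set {1..n}) J = of_bool (J \<in> {1..n}) / n"
      by (subst pmf_of_set) (auto simp: indicator_def)
    have W1: "W (\<pi> 1) = n / N"
      using True r(3) N by (simp add: w_def field_simps)
    have "pmf (bernoulli_pmf (r * (real n + 1) / w) \<bind> (\<lambda>b. pair_pmf (if b then ?S1 else ?S0)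
        (pmf_of_set {1..if b then n + 1 else n}))) (A, J) = pmf ?S0 A * pmf (pmf_of_set {1..n}) J"
      unfolding True by (simp add: pmf_bind integral_bernoulli_pmf pmf_pair)
    then have "pmf (bernoulli_pmf (r * (real n + 1) / w) \<bind> (\<lambda>b. pair_pmf (if b then ?S1 else ?S0)
        (pmf_of_set {1..if b then n + 1 else n}))) (A, J) * W (\<pi> 1) =
        pmf ?S0 A * (of_bool (J \<in> {1..n}) / N)"
      unfolding unif W1 using \<open>n > 0\<close> by simp
    also have "\<dots> = of_bool (A J = \<pi> 1) * (pmf ?S0 A * (of_bool (J \<in> {1..N}) / N))"
      using S0 \<open>n \<le> N\<close> by (cases "A \<in> set_pmf ?S0") (auto simp: set_pmf_iff)
    finally show ?thesis
      unfolding r_def[symmetric] True .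
  next
    case False
    then have r0: "r > 0" using r by simp
    have S1: "A J = \<pi> 1 \<longleftrightarrow> J \<le> n + 1" if A: "A \<in> set_pmf ?S1" and J: "J \<in> {1..N}"
    proof -
      obtain u where u: "A = systematic N W \<pi> u" "0 < u" "u < r"
        using subsetD[OF set_systematic_pmf[OF r0] A] by auto
      then have "A J = \<pi> 1 \<longleftrightarrow> real J - 1 + u \<le> w"
        using r J by (simp only: first)
      also have "\<dots> \<longleftrightarrow> J \<le> n + 1"
        using u r by linarith
      finally show ?thesis .
    qed
    define q where "q = r * (real n + 1) / w"
    have "n + 1 \<le> N" using r0 r w by linarith
    have "r * n \<le> n" using r by (simp add: mult_left_le_one_le)
    then have q: "0 \<le> q" "q \<le> 1"
      using r w unfolding q_def by (auto simp: field_simps)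
    have 1: "q * pmf (pmf_of_set {1..n + 1}) J * W (\<pi> 1) = r * (of_bool (J \<in> {1..n + 1}) / N)"
    proof -
      have "q * W (\<pi> 1) = r * (real n + 1) / N"
        using pos N by (simp add: q_def w_def)
      then show ?thesis
        by (subst pmf_of_set) (auto simp: indicator_def field_simps)
    qed
    have 0: "(1 - q) * pmf (pmf_of_set {1..n}) J * W (\<pi> 1) = (1 - r) * (of_bool (J \<in> {1..n}) / N)"
    proof (cases "n = 0")
      \<comment> \<open>The set \<open>{1..n}\<close> is empty and has no uniform law, but
        \<open>w = r\<close> forces \<open>q = 1\<close>, so the branch has weight 0.\<close>
      case True
      then have "q = 1" using r r0 by (simp add: q_def)
      then show ?thesis using True by simp
    next
      case False
      have "(1 - q) * w = n * (1 - r)"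
        using w r(3) by (simp add: q_def field_simps)
      then have "(1 - q) * W (\<pi> 1) = n * (1 - r) / N"
        using N by (simp add: w_def field_simps)
      then show ?thesis
        using False by (subst pmf_of_set) (auto simp: indicator_def field_simps)
    qed
    have "pmf (bernoulli_pmf q \<bind> (\<lambda>b. pair_pmf (if b then ?S1 else ?S0)
        (pmf_of_set {1..if b then n + 1 else n}))) (A, J) * W (\<pi> 1) =
        pmf ?S1 A * (q * pmf (pmf_of_set {1..n + 1}) J * W (\<pi> 1)) +
        pmf ?S0 A * ((1 - q) * pmf (pmf_of_set {1..n}) J * W (\<pi> 1))"
      unfolding pmf_bind integral_bernoulli_pmf[OF q] by (simp add: pmf_pair algebra_simps)
    also have "\<dots> = r * (pmf ?S1 A * of_bool (J \<in> {1..n + 1})) / N +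
        (1 - r) * (pmf ?S0 A * of_bool (J \<in> {1..n})) / N"
      unfolding 0 1 by (simp add: mult.commute)
    also have "pmf ?S1 A * of_bool (J \<in> {1..n + 1}) = pmf ?S1 A * of_bool (A J = \<pi> 1 \<and> J \<in> {1..N})"
      using S1 \<open>n + 1 \<le> N\<close> by (cases "A \<in> set_pmf ?S1") (auto simp: set_pmf_iff)
    also have "pmf ?S0 A * of_bool (J \<in> {1..n}) = pmf ?S0 A * of_bool (A J = \<pi> 1 \<and> J \<in> {1..N})"
      using S0 \<open>n + 1 \<le> N\<close> by (cases "A \<in> set_pmf ?S0") (auto simp: set_pmf_iff)
    also have "r * (pmf ?S1 A * of_bool (A J = \<pi> 1 \<and> J \<in> {1..N})) / N +
        (1 - r) * (pmf ?S0 A * of_bool (A J = \<pi> 1 \<and> J \<in> {1..N})) / N =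
        of_bool (A J = \<pi> 1) * ((r * pmf ?S1 A + (1 - r) * pmf ?S0 A) * (of_bool (J \<in> {1..N}) / N))"
      using N by (simp add: of_bool_conj field_simps)
    also have "r * pmf ?S1 A + (1 - r) * pmf ?S0 A = pmf (systematic_pmf N W \<pi> 0 1) A"
      using systematic_pmf_split[of 0 r 1 N W \<pi>] r r0
      by (simp add: pmf_bind integral_bernoulli_pmf)
    finally show ?thesis
      unfolding q_def r_def .
  qed
qed

text \<open>The witness keeps the mean partition order with its own start and so does not depend on
  \<open>i\<close>. For each \<open>i\<close> of positive weight it equals the rotated law of the
  order starting at \<open>i\<close>, to which the block computation applies.\<close>

lemma valid_cond_syst:
  assumes "N > 0"
    and R0: "\<And>i k g. i \<in> {1..N} \<Longrightarrow> k \<in> {1..N} \<Longrightarrow> g \<in> weights N \<Longrightarrow> g i = 0 \<Longrightarrow>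
      set_pmf (R0 i k g) \<subseteq> {A \<in> ancestors N. A k = i}"
  shows "valid N (cond_syst N R0)"
proof -
  define W where "W g j = g j / (\<Sum>l=1..N. g l)" for g :: "nat \<Rightarrow> real" and j
  define r where "r g = rotated_pmf N (systematic_pmf N (W g) (mean_partition_order N (W g)) 0 1)" for g
  have W: "\<And>j. j \<in> {1..N} \<Longrightarrow> 0 \<le> W g j" "(\<Sum>j=1..N. W g j) = 1" if "g \<in> weights N" for g
    using weightsD(1,2)[OF that] by (auto simp: W_def simp flip: sum_divide_distrib)
  have perm: "mean_partition_order N (W g) permutes {1..N}" for g
    by (rule mean_partition_order_permutes[OF assms(1)])
  note bij = permutes_imp_bij[OF perm]
  have cond: "measure_pmf.prob (r g) {A. A k = i} = W g i"
    "cond_syst N R0 i k g = cond_pmf (r g) {A. A k = i}"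
    if g: "g \<in> weights N" and i: "i \<in> {1..N}" and k: "k \<in> {1..N}" and pos: "g i > 0" for g i k
  proof -
    note Wg = W[OF g]
    define \<pi> where "\<pi> = mean_partition_order N (W g)"
    define s where "s = inv_into {1..N} \<pi> i"
    define t where "t = s - 1"
    define \<pi>' where "\<pi>' j = \<pi> (shift N (int t) j)" for j
    define w where "w = N * W g i"
    define n where "n = nat \<lfloor>N * W g i\<rfloor>"
    have n_eq: "n = nat \<lfloor>w\<rfloor>" by (simp add: n_def w_def)
    note \<pi> = bij[of g, folded \<pi>_def]
    have "i \<in> \<pi> ` {1..N}" using i \<pi> by (simp add: bij_betw_def)
    then have s: "s \<in> {1..N}" "\<pi> s = i"
      unfolding s_def by (rule inv_into_into, rule f_inv_into_f)
    then have t: "t < N" "int s - 1 = int t" "Suc t = s" by (auto simp: t_def)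
    have \<pi>': "bij_betw \<pi>' {1..N} {1..N}"
      using bij_betw_trans[OF bij_shift[OF assms(1), of "int t"] \<pi>] by (simp add: \<pi>'_def[abs_def] comp_def)
    have "shift N (int t) 1 = s"
      using t s assms(1) by (subst shift_nat) auto
    then have first: "\<pi>' 1 = i" by (simp add: \<pi>'_def s)
    have Wi: "W g i > 0" using pos weightsD(2)[OF g] by (simp add: W_def)
    \<comment> \<open>The positive weight of \<open>i\<close> follows position \<open>t\<close>, so
      the partial sum at \<open>t\<close> is strictly below 1, as the change of start
      requires.\<close>
    have "order_cdf (W g) \<pi> t + W g i = order_cdf (W g) \<pi> (Suc t)"
      using s(2) unfolding order_cdf_def t(3)[symmetric] by simp
    also have "\<dots> \<le> order_cdf (W g) \<pi> N"
    proof (rule order_cdf_mono)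
      show "0 \<le> W g (\<pi> j)" if "j \<in> {1..N}" for j
        using Wg(1) bij_betwE[OF \<pi>] that by blast
    qed (use t in auto)
    also have "\<dots> = 1" using Wg(2) \<pi> by (rule order_cdf_top)
    finally have "order_cdf (W g) \<pi> t < 1" using Wi by simp
    then have r: "r g = rotated_pmf N (systematic_pmf N (W g) \<pi>' 0 1)"
      using rotated_systematic_pmf_order[OF Wg \<pi> t(1)] by (simp add: r_def \<pi>_def \<pi>'_def[abs_def])
    \<comment> \<open>The joint law of the tuple and of the index \<open>C'\<close> drawn from its
      block, which plays the part of \<open>J\<close>.\<close>
    let ?\<nu> = "bernoulli_pmf ((w - n) * (real n + 1) / w) \<bind> (\<lambda>b.
        pair_pmf (if b then systematic_pmf N (W g) \<pi>' 0 (w - n) else systematic_pmf N (W g) \<pi>' (w - n) 1)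
          (pmf_of_set {1..if b then n + 1 else n}))"
    have \<nu>: "pmf ?\<nu> (A, J) * W g i =
        of_bool (A J = i) * (pmf (systematic_pmf N (W g) \<pi>' 0 1) A * (of_bool (J \<in> {1..N}) / N))" for A J
      using pmf_systematic_block[OF Wg \<pi>', of A J] Wi unfolding first w_def n_def by blast
    have "cond_syst N R0 i k g =
        map_pmf (\<lambda>(A, J). rotate_tuple N (int (shift N (- int k) J)) A) ?\<nu>"
      using pos unfolding cond_syst_def Let_def rotate_tuple_def W_def[symmetric] \<pi>_def[symmetric]
        s_def[symmetric] t(2) \<pi>'_def[symmetric] w_def[symmetric]
        n_eq[symmetric]
      by (simp add: add.commute map_pmf_def pair_pmf_def bind_assoc_pmf bind_return_pmf)
    with rotated_pmf_cond[OF \<nu> Wi k]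
    show "measure_pmf.prob (r g) {A. A k = i} = W g i"
      "cond_syst N R0 i k g = cond_pmf (r g) {A. A k = i}"
      unfolding r by simp_all
  qed
  show ?thesis
  proof (rule validI[where r = r])
    have "set_pmf (r g) \<subseteq> ancestors N" if "g \<in> weights N" for g
      unfolding r_def
    proof (rule set_rotated_pmf[OF assms(1)], rule order_trans[OF set_systematic_pmf], simp, rule image_subsetI)
      fix u :: real assume "u \<in> {0<..<1}"
      then show "systematic N (W g) (mean_partition_order N (W g)) u \<in> ancestors N"
        using W[OF that] bij by (intro systematic_ancestors) simp_all
    qed
    then show "is_scheme N r" by (simp add: is_scheme_def)
  next
    fix g p n assume "g \<in> weights N" "p \<in> {1..N}" "n \<in> {1..N}" "g p = 0"
    then show "set_pmf (cond_syst N R0 p n g) \<subseteq> {A \<in> ancestors N. A n = p}"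
      using R0[of p n g] by (simp add: cond_syst_def)
  qed (use cond in \<open>simp_all add: W_def\<close>)
qed

text \<open>The condition on \<open>R0\<close> is what clause (a) and the range of a scheme force at
  zero weights, so the second part holds for every admissible completion of the algorithm.\<close>

theorem lemma6:
  fixes N :: nat
  assumes "N > 0"
  shows "valid N (cond_kill N) \<and>
    (\<forall>R0. (\<forall>i\<in>{1..N}. \<forall>k\<in>{1..N}. \<forall>g\<in>weights N. g i = 0 \<longrightarrow>
              set_pmf (R0 i k g) \<subseteq> {A \<in> ancestors N. A k = i}) \<longrightarrow>
          valid N (cond_syst N R0))"
  using valid_cond_kill[OF assms] valid_cond_syst[OF assms] by blast

end
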